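(* A higher modality is a uniquely eliminating modality, with the same modal types.
   Context: Setting: Martin-Löf dependent type theory with the usual type formers and a univalent universe $\mathcal{U}$ (function extensionality holds). A modal operator is a function $\bigcirc:\mathcal{U}\to\mathcal{U}$, and a modal unit is a family of functions $\eta_A:A\to\bigcirc A$ for $A:\mathcal{U}$. Given these, a type $X:\mathcal{U}$ is modal if $\eta_X:X\to\bigcirc X$ is an equivalence. A higher modality consists of a modal operator and a modal unit together with: (1) for every $A:\mathcal{U}$ and $P:\bigcirc A\to\mathcal{U}$ a function $\mathsf{ind}_{\bigcirc A}:\big(\prod_{a:A}\bigcirc(P(\eta(a)))\big)\to\prod_{z:\bigcirc A}\bigcirc(P(z))$; (2) an identification $\mathsf{ind}_{\bigcirc A}(f)(\eta(x))=f(x)$ for each $f:\prod_{x:A}\bigcirc(P(\eta(x)))$ and $x:A$; (3) for any $x,y:\bigcirc A$, the modal unit $\eta_{(x=y)}:(x=y)\to\bigcirc(x=y)$ is an equivalence. A uniquely eliminating modality consists of a modal operator and a modal unit such that for every $A:\mathcal{U}$ and $P:\bigcirc A\to\mathcal{U}$ the function $\big(\prod_{x:\bigcirc A}\bigcirc(P(x))\big)\to\big(\prod_{a:A}\bigcirc(P(\eta_A(a)))\big)$, $f\mapsto f\circ\eta_A$, is an equivalence. The assertion is that the modal operator and modal unit of the higher modality form a uniquely eliminating modality. *)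

theory Defs
  imports Main
begin

text \<open>
  Martin-Loef type theory with a cumulative hierarchy of univalent universes, in the formal
  presentation of the appendix of the HoTT Book (Russell-style universes, eliminators as term
  formers, function extensionality and univalence as constants).  It is deeply embedded: raw terms
  use de Bruijn indices, and a type is provable if some derivable term inhabits it.
\<close>


section \<open>Raw terms\<close>

text \<open>
  Number of variables bound in each argument:
  \<open>Pi A B\<close>, \<open>Sig A B\<close> and \<open>Lam A b\<close> bind one variable in the second argument.  The motive of each
  eliminator comes first and binds one variable, except in \<open>IndId\<close>, where it binds three (the two
  end points and the path).  The branches bind: \<open>IndSig\<close> two, \<open>IndSum\<close> one each, \<open>IndUnit\<close> none,
  \<open>IndNat\<close> none and two (predecessor, induction hypothesis), \<open>IndId\<close> one.
\<close>

datatype tm =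
    Var nat
  | U nat
  | Pi tm tm
  | Lam tm tm
  | App tm tm  (infixl \<open>\<cdot>\<close> 90)
  | Sig tm tm
  | Pair tm tm
  | IndSig tm tm tm
  | Sum tm tm
  | Inl tm
  | Inr tm
  | IndSum tm tm tm tm
  | Empty
  | IndEmpty tm tm
  | Unit
  | Star
  | IndUnit tm tm tm
  | NatT
  | ZeroN
  | SucN tm
  | IndNat tm tm tm tm
  | Id tm tm tm
  | Refl tm
  | IndId tm tm tm tm tm
  | FunExt nat
  | Univalence nat

fun up_ren :: "(nat \<Rightarrow> nat) \<Rightarrow> nat \<Rightarrow> nat" where
  "up_ren r 0 = 0"
| "up_ren r (Suc n) = Suc (r n)"

primrec ren :: "(nat \<Rightarrow> nat) \<Rightarrow> tm \<Rightarrow> tm" where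
  "ren r (Var n) = Var (r n)"
| "ren r (U i) = U i"
| "ren r (Pi A B) = Pi (ren r A) (ren (up_ren r) B)"
| "ren r (Lam A b) = Lam (ren r A) (ren (up_ren r) b)"
| "ren r (App f a) = App (ren r f) (ren r a)"
| "ren r (Sig A B) = Sig (ren r A) (ren (up_ren r) B)"
| "ren r (Pair a b) = Pair (ren r a) (ren r b)"
| "ren r (IndSig C g p) = IndSig (ren (up_ren r) C) (ren (up_ren (up_ren r)) g) (ren r p)"
| "ren r (Sum A B) = Sum (ren r A) (ren r B)"
| "ren r (Inl a) = Inl (ren r a)"
| "ren r (Inr b) = Inr (ren r b)"
| "ren r (IndSum C c d e) =
    IndSum (ren (up_ren r) C) (ren (up_ren r) c) (ren (up_ren r) d) (ren r e)"
| "ren r Empty = Empty"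
| "ren r (IndEmpty C e) = IndEmpty (ren (up_ren r) C) (ren r e)"
| "ren r Unit = Unit"
| "ren r Star = Star"
| "ren r (IndUnit C c e) = IndUnit (ren (up_ren r) C) (ren r c) (ren r e)"
| "ren r NatT = NatT"
| "ren r ZeroN = ZeroN"
| "ren r (SucN n) = SucN (ren r n)"
| "ren r (IndNat C c d n) =
    IndNat (ren (up_ren r) C) (ren r c) (ren (up_ren (up_ren r)) d) (ren r n)"
| "ren r (Id A a b) = Id (ren r A) (ren r a) (ren r b)"
| "ren r (Refl a) = Refl (ren r a)"
| "ren r (IndId C c a b p) =
    IndId (ren (up_ren (up_ren (up_ren r))) C) (ren (up_ren r) c) (ren r a) (ren r b) (ren r p)"
| "ren r (FunExt i) = FunExt i"
| "ren r (Univalence i) = Univalence i"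

definition shift :: "nat \<Rightarrow> tm \<Rightarrow> tm" where
  "shift k = ren (\<lambda>n. n + k)"

fun scons :: "tm \<Rightarrow> (nat \<Rightarrow> tm) \<Rightarrow> nat \<Rightarrow> tm" where
  "scons a s 0 = a"
| "scons a s (Suc n) = s n"

definition up :: "(nat \<Rightarrow> tm) \<Rightarrow> nat \<Rightarrow> tm" where
  "up s = scons (Var 0) (\<lambda>n. shift 1 (s n))"

primrec subst :: "(nat \<Rightarrow> tm) \<Rightarrow> tm \<Rightarrow> tm" where
  "subst s (Var n) = s n"
| "subst s (U i) = U i"
| "subst s (Pi A B) = Pi (subst s A) (subst (up s) B)"
| "subst s (Lam A b) = Lam (subst s A) (subst (up s) b)"
| "subst s (App f a) = App (subst s f) (subst s a)"
| "subst s (Sig A B) = Sig (subst s A) (subst (up s) B)"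
| "subst s (Pair a b) = Pair (subst s a) (subst s b)"
| "subst s (IndSig C g p) = IndSig (subst (up s) C) (subst (up (up s)) g) (subst s p)"
| "subst s (Sum A B) = Sum (subst s A) (subst s B)"
| "subst s (Inl a) = Inl (subst s a)"
| "subst s (Inr b) = Inr (subst s b)"
| "subst s (IndSum C c d e) =
    IndSum (subst (up s) C) (subst (up s) c) (subst (up s) d) (subst s e)"
| "subst s Empty = Empty"
| "subst s (IndEmpty C e) = IndEmpty (subst (up s) C) (subst s e)"
| "subst s Unit = Unit"
| "subst s Star = Star"
| "subst s (IndUnit C c e) = IndUnit (subst (up s) C) (subst s c) (subst s e)"
| "subst s NatT = NatT"
| "subst s ZeroN = ZeroN"
| "subst s (SucN n) = SucN (subst s n)"
| "subst s (IndNat C c d n) =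
    IndNat (subst (up s) C) (subst s c) (subst (up (up s)) d) (subst s n)"
| "subst s (Id A a b) = Id (subst s A) (subst s a) (subst s b)"
| "subst s (Refl a) = Refl (subst s a)"
| "subst s (IndId C c a b p) =
    IndId (subst (up (up (up s))) C) (subst (up s) c) (subst s a) (subst s b) (subst s p)"
| "subst s (FunExt i) = FunExt i"
| "subst s (Univalence i) = Univalence i"

text \<open>
  \<open>inst k a C\<close> replaces the last variable of \<open>C\<close> by \<open>a\<close>, where \<open>a\<close> lives in the remaining context
  extended by \<open>k\<close> further variables.  \<open>inst3\<close> does so for the last three variables, given in the
  order of the context.
\<close>

definition inst :: "nat \<Rightarrow> tm \<Rightarrow> tm \<Rightarrow> tm" where
  "inst k a C = subst (scons a (\<lambda>n. Var (n + k))) C"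

definition inst3 :: "nat \<Rightarrow> tm \<Rightarrow> tm \<Rightarrow> tm \<Rightarrow> tm \<Rightarrow> tm" where
  "inst3 k a b p C = subst (scons p (scons b (scons a (\<lambda>n. Var (n + k))))) C"

definition arr :: "tm \<Rightarrow> tm \<Rightarrow> tm"  (infixr \<open>\<rightharpoondown>\<close> 60) where
  "A \<rightharpoondown> B = Pi A (shift 1 B)"

definition times :: "tm \<Rightarrow> tm \<Rightarrow> tm"  (infixr \<open>\<otimes>\<close> 65) where
  "A \<otimes> B = Sig A (shift 1 B)"


section \<open>Equivalences and the types of the two axioms\<close>

text \<open>
  \<open>is_equiv A B f\<close> is the (bi-invertibility) type
  \<open>(\<Sum>g : B \<rightarrow> A. \<Prod>y : B. f (g y) = y) \<times> (\<Sum>h : B \<rightarrow> A. \<Prod>x : A. h (f x) = x)\<close>.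
\<close>

definition is_equiv :: "tm \<Rightarrow> tm \<Rightarrow> tm \<Rightarrow> tm" where
  "is_equiv A B f =
    Sig (B \<rightharpoondown> A) (Pi (shift 1 B) (Id (shift 2 B) (shift 2 f \<cdot> (Var 1 \<cdot> Var 0)) (Var 0))) \<otimes>
    Sig (B \<rightharpoondown> A) (Pi (shift 1 A) (Id (shift 2 A) (Var 1 \<cdot> (shift 2 f \<cdot> Var 0)) (Var 0)))"

definition Equiv :: "tm \<Rightarrow> tm \<Rightarrow> tm" where
  "Equiv A B = Sig (A \<rightharpoondown> B) (is_equiv (shift 1 A) (shift 1 B) (Var 0))"

definition id_equiv :: "tm \<Rightarrow> tm" where
  "id_equiv A =
    (let h = Pair (Lam A (Var 0)) (Lam A (Refl (Var 0))) in Pair (Lam A (Var 0)) (Pair h h))"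

text \<open>\<open>happly A B f g : f = g \<rightarrow> (\<Prod>x : A. f x = g x)\<close>, where \<open>B : A \<rightarrow> U\<close>; by path induction.\<close>

definition happly :: "tm \<Rightarrow> tm \<Rightarrow> tm \<Rightarrow> tm \<Rightarrow> tm" where
  "happly A B f g =
    Lam (Id (Pi A (shift 1 B \<cdot> Var 0)) f g)
      (IndId
        (Pi (shift 4 A) (Id (shift 5 B \<cdot> Var 0) (Var 3 \<cdot> Var 0) (Var 2 \<cdot> Var 0)))
        (Lam (shift 2 A) (Refl (Var 1 \<cdot> Var 0)))
        (shift 1 f) (shift 1 g) (Var 0))"

text \<open>\<open>\<Prod>A : U\<^sub>i. \<Prod>B : A \<rightarrow> U\<^sub>i. \<Prod>f g : (\<Prod>x : A. B x). is_equiv happly\<close>\<close>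

definition funext_type :: "nat \<Rightarrow> tm" where
  "funext_type i =
    Pi (U i) (Pi (Var 0 \<rightharpoondown> U i)
      (Pi (Pi (Var 1) (Var 1 \<cdot> Var 0)) (Pi (Pi (Var 2) (Var 2 \<cdot> Var 0))
        (is_equiv
          (Id (Pi (Var 3) (Var 3 \<cdot> Var 0)) (Var 1) (Var 0))
          (Pi (Var 3) (Id (Var 3 \<cdot> Var 0) (Var 2 \<cdot> Var 0) (Var 1 \<cdot> Var 0)))
          (happly (Var 3) (Var 2) (Var 1) (Var 0))))))"

text \<open>\<open>id_to_equiv i A B : (A = B) \<rightarrow> Equiv A B\<close>, the equality being taken in \<open>U\<^sub>i\<close>.\<close>

definition id_to_equiv :: "nat \<Rightarrow> tm \<Rightarrow> tm \<Rightarrow> tm" where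
  "id_to_equiv i A B =
    Lam (Id (U i) A B)
      (IndId (Equiv (Var 2) (Var 1)) (id_equiv (Var 0)) (shift 1 A) (shift 1 B) (Var 0))"

definition univalence_type :: "nat \<Rightarrow> tm" where
  "univalence_type i =
    Pi (U i) (Pi (U i)
      (is_equiv (Id (U i) (Var 1) (Var 0)) (Equiv (Var 1) (Var 0)) (id_to_equiv i (Var 1) (Var 0))))"


section \<open>Judgements\<close>

text \<open>The head of a context is its most recently declared variable.\<close>

type_synonym ctx = "tm list"

inductive
  wf_ctx :: "ctx \<Rightarrow> bool" and
  typing :: "ctx \<Rightarrow> tm \<Rightarrow> tm \<Rightarrow> bool"  (\<open>(_ \<turnstile> _ \<Colon> _)\<close> [51, 51, 51] 50) and
  judg_eq :: "ctx \<Rightarrow> tm \<Rightarrow> tm \<Rightarrow> tm \<Rightarrow> bool"  (\<open>(_ \<turnstile> _ \<doteq> _ \<Colon> _)\<close> [51, 51, 51, 51] 50)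
where
  ctx_emp: "wf_ctx []"
| ctx_ext: "G \<turnstile> A \<Colon> U i \<Longrightarrow> wf_ctx (A # G)"

| Var: "wf_ctx G \<Longrightarrow> n < length G \<Longrightarrow> G \<turnstile> Var n \<Colon> shift (Suc n) (G ! n)"
| conv: "G \<turnstile> a \<Colon> A \<Longrightarrow> G \<turnstile> A \<doteq> B \<Colon> U i \<Longrightarrow> G \<turnstile> a \<Colon> B"
| eq_conv: "G \<turnstile> a \<doteq> b \<Colon> A \<Longrightarrow> G \<turnstile> A \<doteq> B \<Colon> U i \<Longrightarrow> G \<turnstile> a \<doteq> b \<Colon> B"
| eq_refl: "G \<turnstile> a \<Colon> A \<Longrightarrow> G \<turnstile> a \<doteq> a \<Colon> A"
| eq_sym: "G \<turnstile> a \<doteq> b \<Colon> A \<Longrightarrow> G \<turnstile> b \<doteq> a \<Colon> A"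
| eq_trans: "G \<turnstile> a \<doteq> b \<Colon> A \<Longrightarrow> G \<turnstile> b \<doteq> c \<Colon> A \<Longrightarrow> G \<turnstile> a \<doteq> c \<Colon> A"

| U_intro: "wf_ctx G \<Longrightarrow> G \<turnstile> U i \<Colon> U (Suc i)"
| U_cumul: "G \<turnstile> A \<Colon> U i \<Longrightarrow> G \<turnstile> A \<Colon> U (Suc i)"
| U_cumul_eq: "G \<turnstile> A \<doteq> B \<Colon> U i \<Longrightarrow> G \<turnstile> A \<doteq> B \<Colon> U (Suc i)"

| Pi_form: "G \<turnstile> A \<Colon> U i \<Longrightarrow> A # G \<turnstile> B \<Colon> U i \<Longrightarrow> G \<turnstile> Pi A B \<Colon> U i"
| Pi_form_eq:
    "G \<turnstile> A \<Colon> U i \<Longrightarrow> G \<turnstile> A \<doteq> A' \<Colon> U i \<Longrightarrow> A # G \<turnstile> B \<doteq> B' \<Colon> U i \<Longrightarrow> G \<turnstile> Pi A B \<doteq> Pi A' B' \<Colon> U i"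
| Pi_intro: "A # G \<turnstile> b \<Colon> B \<Longrightarrow> G \<turnstile> Lam A b \<Colon> Pi A B"
| Pi_intro_eq:
    "G \<turnstile> A \<doteq> A' \<Colon> U i \<Longrightarrow> A # G \<turnstile> b \<doteq> b' \<Colon> B \<Longrightarrow> G \<turnstile> Lam A b \<doteq> Lam A' b' \<Colon> Pi A B"
| Pi_elim: "G \<turnstile> f \<Colon> Pi A B \<Longrightarrow> G \<turnstile> a \<Colon> A \<Longrightarrow> G \<turnstile> f \<cdot> a \<Colon> inst 0 a B"
| Pi_elim_eq:
    "G \<turnstile> f \<doteq> f' \<Colon> Pi A B \<Longrightarrow> G \<turnstile> a \<doteq> a' \<Colon> A \<Longrightarrow> G \<turnstile> f \<cdot> a \<doteq> f' \<cdot> a' \<Colon> inst 0 a B"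
| Pi_comp:
    "A # G \<turnstile> b \<Colon> B \<Longrightarrow> G \<turnstile> a \<Colon> A \<Longrightarrow> G \<turnstile> Lam A b \<cdot> a \<doteq> inst 0 a b \<Colon> inst 0 a B"
| Pi_uniq: "G \<turnstile> f \<Colon> Pi A B \<Longrightarrow> G \<turnstile> f \<doteq> Lam A (shift 1 f \<cdot> Var 0) \<Colon> Pi A B"

| Sig_form: "G \<turnstile> A \<Colon> U i \<Longrightarrow> A # G \<turnstile> B \<Colon> U i \<Longrightarrow> G \<turnstile> Sig A B \<Colon> U i"
| Sig_form_eq:
    "G \<turnstile> A \<Colon> U i \<Longrightarrow> G \<turnstile> A \<doteq> A' \<Colon> U i \<Longrightarrow> A # G \<turnstile> B \<doteq> B' \<Colon> U i \<Longrightarrow> G \<turnstile> Sig A B \<doteq> Sig A' B' \<Colon> U i"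
| Sig_intro:
    "A # G \<turnstile> B \<Colon> U i \<Longrightarrow> G \<turnstile> a \<Colon> A \<Longrightarrow> G \<turnstile> b \<Colon> inst 0 a B \<Longrightarrow> G \<turnstile> Pair a b \<Colon> Sig A B"
| Sig_intro_eq:
    "A # G \<turnstile> B \<Colon> U i \<Longrightarrow> G \<turnstile> a \<doteq> a' \<Colon> A \<Longrightarrow> G \<turnstile> b \<doteq> b' \<Colon> inst 0 a B
      \<Longrightarrow> G \<turnstile> Pair a b \<doteq> Pair a' b' \<Colon> Sig A B"
| Sig_elim:
    "Sig A B # G \<turnstile> C \<Colon> U i \<Longrightarrow> B # A # G \<turnstile> g \<Colon> inst 2 (Pair (Var 1) (Var 0)) C
      \<Longrightarrow> G \<turnstile> p \<Colon> Sig A B \<Longrightarrow> G \<turnstile> IndSig C g p \<Colon> inst 0 p C"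
| Sig_elim_eq:
    "Sig A B # G \<turnstile> C \<doteq> C' \<Colon> U i \<Longrightarrow> B # A # G \<turnstile> g \<doteq> g' \<Colon> inst 2 (Pair (Var 1) (Var 0)) C
      \<Longrightarrow> G \<turnstile> p \<doteq> p' \<Colon> Sig A B \<Longrightarrow> G \<turnstile> IndSig C g p \<doteq> IndSig C' g' p' \<Colon> inst 0 p C"
| Sig_comp:
    "Sig A B # G \<turnstile> C \<Colon> U i \<Longrightarrow> B # A # G \<turnstile> g \<Colon> inst 2 (Pair (Var 1) (Var 0)) C
      \<Longrightarrow> G \<turnstile> a \<Colon> A \<Longrightarrow> G \<turnstile> b \<Colon> inst 0 a B
      \<Longrightarrow> G \<turnstile> IndSig C g (Pair a b) \<doteq> subst (scons b (scons a Var)) g \<Colon> inst 0 (Pair a b) C"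

| Sum_form: "G \<turnstile> A \<Colon> U i \<Longrightarrow> G \<turnstile> B \<Colon> U i \<Longrightarrow> G \<turnstile> Sum A B \<Colon> U i"
| Sum_form_eq:
    "G \<turnstile> A \<doteq> A' \<Colon> U i \<Longrightarrow> G \<turnstile> B \<doteq> B' \<Colon> U i \<Longrightarrow> G \<turnstile> Sum A B \<doteq> Sum A' B' \<Colon> U i"
| Inl: "G \<turnstile> B \<Colon> U i \<Longrightarrow> G \<turnstile> a \<Colon> A \<Longrightarrow> G \<turnstile> Inl a \<Colon> Sum A B"
| Inl_eq: "G \<turnstile> B \<Colon> U i \<Longrightarrow> G \<turnstile> a \<doteq> a' \<Colon> A \<Longrightarrow> G \<turnstile> Inl a \<doteq> Inl a' \<Colon> Sum A B"
| Inr: "G \<turnstile> A \<Colon> U i \<Longrightarrow> G \<turnstile> b \<Colon> B \<Longrightarrow> G \<turnstile> Inr b \<Colon> Sum A B"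
| Inr_eq: "G \<turnstile> A \<Colon> U i \<Longrightarrow> G \<turnstile> b \<doteq> b' \<Colon> B \<Longrightarrow> G \<turnstile> Inr b \<doteq> Inr b' \<Colon> Sum A B"
| Sum_elim:
    "Sum A B # G \<turnstile> C \<Colon> U i \<Longrightarrow> A # G \<turnstile> c \<Colon> inst 1 (Inl (Var 0)) C
      \<Longrightarrow> B # G \<turnstile> d \<Colon> inst 1 (Inr (Var 0)) C \<Longrightarrow> G \<turnstile> e \<Colon> Sum A B
      \<Longrightarrow> G \<turnstile> IndSum C c d e \<Colon> inst 0 e C"
| Sum_elim_eq:
    "Sum A B # G \<turnstile> C \<doteq> C' \<Colon> U i \<Longrightarrow> A # G \<turnstile> c \<doteq> c' \<Colon> inst 1 (Inl (Var 0)) C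
      \<Longrightarrow> B # G \<turnstile> d \<doteq> d' \<Colon> inst 1 (Inr (Var 0)) C \<Longrightarrow> G \<turnstile> e \<doteq> e' \<Colon> Sum A B
      \<Longrightarrow> G \<turnstile> IndSum C c d e \<doteq> IndSum C' c' d' e' \<Colon> inst 0 e C"
| Sum_comp_Inl:
    "Sum A B # G \<turnstile> C \<Colon> U i \<Longrightarrow> A # G \<turnstile> c \<Colon> inst 1 (Inl (Var 0)) C
      \<Longrightarrow> B # G \<turnstile> d \<Colon> inst 1 (Inr (Var 0)) C \<Longrightarrow> G \<turnstile> a \<Colon> A
      \<Longrightarrow> G \<turnstile> IndSum C c d (Inl a) \<doteq> inst 0 a c \<Colon> inst 0 (Inl a) C"
| Sum_comp_Inr:
    "Sum A B # G \<turnstile> C \<Colon> U i \<Longrightarrow> A # G \<turnstile> c \<Colon> inst 1 (Inl (Var 0)) C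
      \<Longrightarrow> B # G \<turnstile> d \<Colon> inst 1 (Inr (Var 0)) C \<Longrightarrow> G \<turnstile> b \<Colon> B
      \<Longrightarrow> G \<turnstile> IndSum C c d (Inr b) \<doteq> inst 0 b d \<Colon> inst 0 (Inr b) C"

| Empty_form: "wf_ctx G \<Longrightarrow> G \<turnstile> Empty \<Colon> U i"
| Empty_elim: "Empty # G \<turnstile> C \<Colon> U i \<Longrightarrow> G \<turnstile> e \<Colon> Empty \<Longrightarrow> G \<turnstile> IndEmpty C e \<Colon> inst 0 e C"
| Empty_elim_eq:
    "Empty # G \<turnstile> C \<doteq> C' \<Colon> U i \<Longrightarrow> G \<turnstile> e \<doteq> e' \<Colon> Empty
      \<Longrightarrow> G \<turnstile> IndEmpty C e \<doteq> IndEmpty C' e' \<Colon> inst 0 e C"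

| Unit_form: "wf_ctx G \<Longrightarrow> G \<turnstile> Unit \<Colon> U i"
| Unit_intro: "wf_ctx G \<Longrightarrow> G \<turnstile> Star \<Colon> Unit"
| Unit_elim:
    "Unit # G \<turnstile> C \<Colon> U i \<Longrightarrow> G \<turnstile> c \<Colon> inst 0 Star C \<Longrightarrow> G \<turnstile> e \<Colon> Unit
      \<Longrightarrow> G \<turnstile> IndUnit C c e \<Colon> inst 0 e C"
| Unit_elim_eq:
    "Unit # G \<turnstile> C \<doteq> C' \<Colon> U i \<Longrightarrow> G \<turnstile> c \<doteq> c' \<Colon> inst 0 Star C \<Longrightarrow> G \<turnstile> e \<doteq> e' \<Colon> Unit
      \<Longrightarrow> G \<turnstile> IndUnit C c e \<doteq> IndUnit C' c' e' \<Colon> inst 0 e C"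
| Unit_comp:
    "Unit # G \<turnstile> C \<Colon> U i \<Longrightarrow> G \<turnstile> c \<Colon> inst 0 Star C \<Longrightarrow> G \<turnstile> IndUnit C c Star \<doteq> c \<Colon> inst 0 Star C"

| Nat_form: "wf_ctx G \<Longrightarrow> G \<turnstile> NatT \<Colon> U i"
| Nat_zero: "wf_ctx G \<Longrightarrow> G \<turnstile> ZeroN \<Colon> NatT"
| Nat_suc: "G \<turnstile> n \<Colon> NatT \<Longrightarrow> G \<turnstile> SucN n \<Colon> NatT"
| Nat_suc_eq: "G \<turnstile> n \<doteq> n' \<Colon> NatT \<Longrightarrow> G \<turnstile> SucN n \<doteq> SucN n' \<Colon> NatT"
| Nat_elim:
    "NatT # G \<turnstile> C \<Colon> U i \<Longrightarrow> G \<turnstile> c \<Colon> inst 0 ZeroN C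
      \<Longrightarrow> C # NatT # G \<turnstile> d \<Colon> inst 2 (SucN (Var 1)) C \<Longrightarrow> G \<turnstile> n \<Colon> NatT
      \<Longrightarrow> G \<turnstile> IndNat C c d n \<Colon> inst 0 n C"
| Nat_elim_eq:
    "NatT # G \<turnstile> C \<doteq> C' \<Colon> U i \<Longrightarrow> G \<turnstile> c \<doteq> c' \<Colon> inst 0 ZeroN C
      \<Longrightarrow> C # NatT # G \<turnstile> d \<doteq> d' \<Colon> inst 2 (SucN (Var 1)) C \<Longrightarrow> G \<turnstile> n \<doteq> n' \<Colon> NatT
      \<Longrightarrow> G \<turnstile> IndNat C c d n \<doteq> IndNat C' c' d' n' \<Colon> inst 0 n C"
| Nat_comp_zero:
    "NatT # G \<turnstile> C \<Colon> U i \<Longrightarrow> G \<turnstile> c \<Colon> inst 0 ZeroN C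
      \<Longrightarrow> C # NatT # G \<turnstile> d \<Colon> inst 2 (SucN (Var 1)) C
      \<Longrightarrow> G \<turnstile> IndNat C c d ZeroN \<doteq> c \<Colon> inst 0 ZeroN C"
| Nat_comp_suc:
    "NatT # G \<turnstile> C \<Colon> U i \<Longrightarrow> G \<turnstile> c \<Colon> inst 0 ZeroN C
      \<Longrightarrow> C # NatT # G \<turnstile> d \<Colon> inst 2 (SucN (Var 1)) C \<Longrightarrow> G \<turnstile> n \<Colon> NatT
      \<Longrightarrow> G \<turnstile> IndNat C c d (SucN n) \<doteq> subst (scons (IndNat C c d n) (scons n Var)) d
            \<Colon> inst 0 (SucN n) C"

| Id_form: "G \<turnstile> A \<Colon> U i \<Longrightarrow> G \<turnstile> a \<Colon> A \<Longrightarrow> G \<turnstile> b \<Colon> A \<Longrightarrow> G \<turnstile> Id A a b \<Colon> U i"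
| Id_form_eq:
    "G \<turnstile> A \<doteq> A' \<Colon> U i \<Longrightarrow> G \<turnstile> a \<doteq> a' \<Colon> A \<Longrightarrow> G \<turnstile> b \<doteq> b' \<Colon> A
      \<Longrightarrow> G \<turnstile> Id A a b \<doteq> Id A' a' b' \<Colon> U i"
| Id_intro: "G \<turnstile> A \<Colon> U i \<Longrightarrow> G \<turnstile> a \<Colon> A \<Longrightarrow> G \<turnstile> Refl a \<Colon> Id A a a"
| Id_intro_eq: "G \<turnstile> A \<Colon> U i \<Longrightarrow> G \<turnstile> a \<doteq> a' \<Colon> A \<Longrightarrow> G \<turnstile> Refl a \<doteq> Refl a' \<Colon> Id A a a"
| Id_elim:
    "Id (shift 2 A) (Var 1) (Var 0) # shift 1 A # A # G \<turnstile> C \<Colon> U i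
      \<Longrightarrow> A # G \<turnstile> c \<Colon> inst3 1 (Var 0) (Var 0) (Refl (Var 0)) C
      \<Longrightarrow> G \<turnstile> a \<Colon> A \<Longrightarrow> G \<turnstile> b \<Colon> A \<Longrightarrow> G \<turnstile> p \<Colon> Id A a b
      \<Longrightarrow> G \<turnstile> IndId C c a b p \<Colon> inst3 0 a b p C"
| Id_elim_eq:
    "Id (shift 2 A) (Var 1) (Var 0) # shift 1 A # A # G \<turnstile> C \<doteq> C' \<Colon> U i
      \<Longrightarrow> A # G \<turnstile> c \<doteq> c' \<Colon> inst3 1 (Var 0) (Var 0) (Refl (Var 0)) C
      \<Longrightarrow> G \<turnstile> a \<doteq> a' \<Colon> A \<Longrightarrow> G \<turnstile> b \<doteq> b' \<Colon> A \<Longrightarrow> G \<turnstile> p \<doteq> p' \<Colon> Id A a b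
      \<Longrightarrow> G \<turnstile> IndId C c a b p \<doteq> IndId C' c' a' b' p' \<Colon> inst3 0 a b p C"
| Id_comp:
    "Id (shift 2 A) (Var 1) (Var 0) # shift 1 A # A # G \<turnstile> C \<Colon> U i
      \<Longrightarrow> A # G \<turnstile> c \<Colon> inst3 1 (Var 0) (Var 0) (Refl (Var 0)) C \<Longrightarrow> G \<turnstile> a \<Colon> A
      \<Longrightarrow> G \<turnstile> IndId C c a a (Refl a) \<doteq> inst 0 a c \<Colon> inst3 0 a a (Refl a) C"

| FunExt: "wf_ctx G \<Longrightarrow> G \<turnstile> FunExt i \<Colon> funext_type i"
| Univalence: "wf_ctx G \<Longrightarrow> G \<turnstile> Univalence i \<Colon> univalence_type i"


section \<open>Modalities on the universe \<open>U\<^sub>i\<close>\<close>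

text \<open>Here \<open>M : U\<^sub>i \<rightarrow> U\<^sub>i\<close> is a modal operator and \<open>e : unit_type i M\<close> a modal unit.\<close>

definition operator_type :: "nat \<Rightarrow> tm" where
  "operator_type i = U i \<rightharpoondown> U i"

text \<open>\<open>\<Prod>A : U\<^sub>i. A \<rightarrow> M A\<close>\<close>

definition unit_type :: "nat \<Rightarrow> tm \<Rightarrow> tm" where
  "unit_type i M = Pi (U i) (Var 0 \<rightharpoondown> shift 1 M \<cdot> Var 0)"

definition is_modal :: "tm \<Rightarrow> tm \<Rightarrow> tm \<Rightarrow> tm" where
  "is_modal M e X = is_equiv X (M \<cdot> X) (e \<cdot> X)"

text \<open>\<open>\<Prod>x : X. M (P (f x))\<close>\<close>

definition modal_sections :: "tm \<Rightarrow> tm \<Rightarrow> tm \<Rightarrow> tm \<Rightarrow> tm" where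
  "modal_sections M X P f = Pi X (shift 1 M \<cdot> (shift 1 P \<cdot> (shift 1 f \<cdot> Var 0)))"

text \<open>\<open>\<Prod>z : M A. M (P z)\<close>\<close>

definition modal_family :: "tm \<Rightarrow> tm \<Rightarrow> tm \<Rightarrow> tm" where
  "modal_family M A P = Pi (M \<cdot> A) (shift 1 M \<cdot> (shift 1 P \<cdot> Var 0))"

text \<open>\<open>\<Prod>A : U\<^sub>i. \<Prod>P : M A \<rightarrow> U\<^sub>i. (\<Prod>a : A. M (P (e A a))) \<rightarrow> \<Prod>z : M A. M (P z)\<close>\<close>

definition ind_type :: "nat \<Rightarrow> tm \<Rightarrow> tm \<Rightarrow> tm" where
  "ind_type i M e =
    Pi (U i) (Pi (shift 1 M \<cdot> Var 0 \<rightharpoondown> U i)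
      (modal_sections (shift 2 M) (Var 1) (Var 0) (shift 2 e \<cdot> Var 1) \<rightharpoondown>
       modal_family (shift 2 M) (Var 1) (Var 0)))"

text \<open>
  \<open>\<Prod>A : U\<^sub>i. \<Prod>P : M A \<rightarrow> U\<^sub>i. \<Prod>f : (\<Prod>a : A. M (P (e A a))). \<Prod>x : A. ind A P f (e A x) = f x\<close>
\<close>

definition comp_type :: "nat \<Rightarrow> tm \<Rightarrow> tm \<Rightarrow> tm \<Rightarrow> tm" where
  "comp_type i M e ind =
    Pi (U i) (Pi (shift 1 M \<cdot> Var 0 \<rightharpoondown> U i)
      (Pi (modal_sections (shift 2 M) (Var 1) (Var 0) (shift 2 e \<cdot> Var 1))
        (Pi (Var 2)
          (Id (shift 4 M \<cdot> (Var 2 \<cdot> (shift 4 e \<cdot> Var 3 \<cdot> Var 0)))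
            (shift 4 ind \<cdot> Var 3 \<cdot> Var 2 \<cdot> Var 1 \<cdot> (shift 4 e \<cdot> Var 3 \<cdot> Var 0))
            (Var 1 \<cdot> Var 0)))))"

text \<open>\<open>\<Prod>A : U\<^sub>i. \<Prod>x y : M A. is_modal (x = y)\<close>\<close>

definition modal_id_type :: "nat \<Rightarrow> tm \<Rightarrow> tm \<Rightarrow> tm" where
  "modal_id_type i M e =
    Pi (U i) (Pi (shift 1 M \<cdot> Var 0) (Pi (shift 2 M \<cdot> Var 1)
      (is_modal (shift 3 M) (shift 3 e) (Id (shift 3 M \<cdot> Var 2) (Var 1) (Var 0)))))"

definition higher_modality_structure :: "nat \<Rightarrow> tm \<Rightarrow> tm \<Rightarrow> tm" where
  "higher_modality_structure i M e =
    Sig (ind_type i M e) (comp_type i (shift 1 M) (shift 1 e) (Var 0)) \<otimes> modal_id_type i M e"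

text \<open>
  \<open>\<Prod>A : U\<^sub>i. \<Prod>P : M A \<rightarrow> U\<^sub>i. is_equiv (\<lambda>f : (\<Prod>z : M A. M (P z)). \<lambda>a : A. f (e A a))\<close>
\<close>

definition unique_elim_structure :: "nat \<Rightarrow> tm \<Rightarrow> tm \<Rightarrow> tm" where
  "unique_elim_structure i M e =
    Pi (U i) (Pi (shift 1 M \<cdot> Var 0 \<rightharpoondown> U i)
      (is_equiv
        (modal_family (shift 2 M) (Var 1) (Var 0))
        (modal_sections (shift 2 M) (Var 1) (Var 0) (shift 2 e \<cdot> Var 1))
        (Lam (modal_family (shift 2 M) (Var 1) (Var 0))
          (Lam (Var 2) (Var 1 \<cdot> (shift 4 e \<cdot> Var 3 \<cdot> Var 0))))))"

definition Higher_Modality :: "nat \<Rightarrow> tm" where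
  "Higher_Modality i =
    Sig (operator_type i) (Sig (unit_type i (Var 0)) (higher_modality_structure i (Var 1) (Var 0)))"

definition Uniquely_Eliminating_Modality :: "nat \<Rightarrow> tm" where
  "Uniquely_Eliminating_Modality i =
    Sig (operator_type i) (Sig (unit_type i (Var 0)) (unique_elim_structure i (Var 1) (Var 0)))"

text \<open>
  First and second component of a term of either of the last two types; the motive of
  \<open>unit_of\<close> is \<open>\<lambda>m. unit_type i (operator_of i m)\<close>.
\<close>

definition operator_of :: "nat \<Rightarrow> tm \<Rightarrow> tm" where
  "operator_of i m = IndSig (operator_type i) (Var 1) m"

definition unit_of :: "nat \<Rightarrow> tm \<Rightarrow> tm" where
  "unit_of i m =
    IndSig (unit_type i (operator_of i (Var 0))) (IndSig (unit_type i (Var 2)) (Var 1) (Var 0)) m"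

end

theory Submission
  imports Defs
begin

text \<open>
  Let \<open>M\<close>, \<open>e\<close> be the operator and unit of a higher modality.  For \<open>P : M A \<rightarrow> U\<close>, write \<open>F\<close> for
  restriction along the unit, \<open>s \<mapsto> \<lambda>a. s (e A a)\<close>.  The claim is that \<open>ind A P\<close> is a two-sided
  inverse of \<open>F\<close>.  The law \<open>F (ind A P f) = f\<close> is the computation rule and function extensionality
  (\<open>restriction_ind\<close>).  For \<open>ind A P (F s) = s\<close>, function extensionality leaves the family
  \<open>Q z = (ind A P (F s) z = s z)\<close> over \<open>M A\<close> to be inhabited.  The computation rule inhabits
  \<open>Q (e A a)\<close>, hence \<open>M (Q (e A a))\<close>, so \<open>ind A Q\<close> produces an element of \<open>M (Q z)\<close> for every \<open>z\<close>.  Since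
  \<open>Q z\<close> is an identity type of \<open>M (P z)\<close> it is modal, and the inverse of its unit takes this element
  to \<open>Q z\<close> (\<open>ind_restriction_pointwise\<close>).  A bi-invertible map asks for no coherence between the
  two laws, and therefore the argument contains no calculation with paths.

  Operator and unit are kept, so the modal types stay the same; in the syntax this is the \<open>\<beta>\<close>-rule
  for the pairing of the old operator and unit with the new structure.

  The derivations are carried out for arbitrary terms in an arbitrary context, and proof terms are
  left existential.  Going under a binder then needs one metatheorem, stability of the judgements
  under renaming (\<open>renaming_stable\<close>).  General substitution is avoided by two devices.  Congruence of a
  type in its variables comes from the congruence rule for application and \<open>\<beta>\<close>, applied to the
  type abstracted over these variables (\<open>type_cong\<close>, \<open>data_type_cong\<close>).  And the only proof term that
  enters the final map is first closed off by \<open>\<lambda>\<close>-abstraction, so that substitution leaves it alone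
  (\<open>closed_subst\<close>).
\<close>

section \<open>Renaming and substitution\<close>

lemma up_ren_comp: "(\<lambda>n. up_ren r (up_ren q n)) = up_ren (\<lambda>n. r (q n))"
  by (rule ext, rename_tac n, case_tac n) auto

lemma ren_ren: "ren r (ren q t) = ren (\<lambda>n. r (q n)) t"
  by (induction t arbitrary: r q) (simp_all add: up_ren_comp)

lemma up_0: "up s 0 = Var 0"
  and up_Suc: "up s (Suc n) = ren Suc (s n)"
  by (simp_all add: up_def shift_def)

lemma up_Var: "up (\<lambda>n. Var (r n)) = (\<lambda>n. Var (up_ren r n))"
  by (rule ext, rename_tac n, case_tac n) (auto simp: up_0 up_Suc)

lemma ren_as_subst: "ren r t = subst (\<lambda>n. Var (r n)) t"
  by (induction t arbitrary: r) (simp_all add: up_Var)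

lemma up_up_ren: "(\<lambda>n. up s (up_ren r n)) = up (\<lambda>n. s (r n))"
  by (rule ext, rename_tac n, case_tac n) (auto simp: up_0 up_Suc)

lemma subst_ren: "subst s (ren r t) = subst (\<lambda>n. s (r n)) t"
  by (induction t arbitrary: s r) (simp_all add: up_up_ren)

lemma ren_up: "(\<lambda>n. ren (up_ren r) (up s n)) = up (\<lambda>n. ren r (s n))"
  by (rule ext, rename_tac n, case_tac n) (auto simp: up_0 up_Suc ren_ren)

lemma ren_subst: "ren r (subst s t) = subst (\<lambda>n. ren r (s n)) t"
  by (induction t arbitrary: s r) (simp_all add: ren_up)

lemma subst_up_up: "(\<lambda>n. subst (up s) (up q n)) = up (\<lambda>n. subst s (q n))"
  by (rule ext, rename_tac n, case_tac n) (auto simp: up_0 up_Suc subst_ren ren_subst)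

lemma subst_subst: "subst s (subst q t) = subst (\<lambda>n. subst s (q n)) t"
  by (induction t arbitrary: s q) (simp_all add: subst_up_up)

lemma up_id: "up Var = Var"
  by (rule ext, rename_tac n, case_tac n) (auto simp: up_0 up_Suc)

lemma subst_Var: "subst Var t = t"
  by (induction t) (simp_all add: up_id)

lemma ren_id: "ren (\<lambda>n. n) t = t"
  by (simp add: ren_as_subst subst_Var)

lemma subst_Var_ren: "subst (\<lambda>n. Var (r n)) t = ren r t"
  by (simp add: ren_as_subst)

text \<open>
  These rules compute substitutions of metavariable terms.  Shifts become renamings \<open>\<lambda>n. Suc (\<dots> n)\<close>, to
  which \<open>up\<close> and \<open>scons\<close> can be applied, and numerals are unfolded to make this possible; consecutive
  renamings and substitutions merge into one.
\<close>
lemmas calc = inst_def inst3_def shift_def ren_ren subst_ren ren_subst up_0 up_Suc subst_Var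
  ren_id subst_Var_ren numeral_eq_Suc

section \<open>Stability under renaming\<close>

definition renaming :: "ctx \<Rightarrow> (nat \<Rightarrow> nat) \<Rightarrow> ctx \<Rightarrow> bool" where
  "renaming D r G \<longleftrightarrow> wf_ctx D \<and>
    (\<forall>n < length G. r n < length D \<and> shift (Suc (r n)) (D ! r n) = ren r (shift (Suc n) (G ! n)))"

definition renamable :: "ctx \<Rightarrow> tm \<Rightarrow> tm \<Rightarrow> bool" where
  "renamable G a A \<longleftrightarrow> (\<forall>D r. renaming D r G \<longrightarrow> D \<turnstile> ren r a \<Colon> ren r A)"

definition renamable_eq :: "ctx \<Rightarrow> tm \<Rightarrow> tm \<Rightarrow> tm \<Rightarrow> bool" where
  "renamable_eq G a b A \<longleftrightarrow> (\<forall>D r. renaming D r G \<longrightarrow> D \<turnstile> ren r a \<doteq> ren r b \<Colon> ren r A)"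

text \<open>
  A rule such as \<open>Pi_intro\<close> has no premise stating that the type of the bound variable is well formed, so
  an induction hypothesis for that type has to come from elsewhere.  It is stored in the context:
  the induction proves of each judgement that all entries of its context are themselves renamable.
\<close>
primrec renamable_ctx :: "ctx \<Rightarrow> bool" where
  "renamable_ctx [] \<longleftrightarrow> True"
| "renamable_ctx (A # G) \<longleftrightarrow> (\<exists>i. renamable G A (U i)) \<and> renamable_ctx G"

lemma renaming_ext:
  assumes "renamable_ctx (A # G)" "renaming D r G"
  shows "renaming (ren r A # D) (up_ren r) (A # G)"
proof -
  obtain i where "D \<turnstile> ren r A \<Colon> U i"
    using assms by (auto simp: renamable_def)
  then have "wf_ctx (ren r A # D)"
    by (rule ctx_ext)
  moreover have "up_ren r n < length (ren r A # D) \<and>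
      shift (Suc (up_ren r n)) ((ren r A # D) ! up_ren r n) = ren (up_ren r) (shift (Suc n) ((A # G) ! n))"
    if n: "n < length (A # G)" for n
  proof (cases n)
    case 0
    then show ?thesis by (simp add: calc)
  next
    case (Suc k)
    then have *: "r k < length D" "shift (Suc (r k)) (D ! r k) = ren r (shift (Suc k) (G ! k))"
      using n assms(2) by (auto simp: renaming_def)
    from *(2) have "ren Suc (shift (Suc (r k)) (D ! r k)) = ren Suc (ren r (shift (Suc k) (G ! k)))"
      by simp
    then show ?thesis using * Suc by (simp add: calc)
  qed
  ultimately show ?thesis by (simp add: renaming_def)
qed

lemma subst_eqI: "(\<And>n. s n = s' n) \<Longrightarrow> subst s t = subst s' t"
  by (rule arg_cong[where f="\<lambda>s. subst s t"]) (rule ext)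

lemma scons_case: "scons a s n = (case n of 0 \<Rightarrow> a | Suc k \<Rightarrow> s k)"
  and up_ren_case: "up_ren r n = (case n of 0 \<Rightarrow> 0 | Suc k \<Rightarrow> Suc (r k))"
  by (cases n; simp)+

lemma ren_inst:
  "ren r (inst 0 a C) = inst 0 (ren r a) (ren (up_ren r) C)"
  "ren (up_ren r) (inst (Suc 0) a C) = inst (Suc 0) (ren (up_ren r) a) (ren (up_ren r) C)"
  "ren (up_ren (up_ren r)) (inst 2 a C) = inst 2 (ren (up_ren (up_ren r)) a) (ren (up_ren r) C)"
  "ren r (inst3 0 a b p D) =
    inst3 0 (ren r a) (ren r b) (ren r p) (ren (up_ren (up_ren (up_ren r))) D)"
  "ren (up_ren r) (inst3 (Suc 0) a b p D) =
    inst3 (Suc 0) (ren (up_ren r) a) (ren (up_ren r) b) (ren (up_ren r) p)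
      (ren (up_ren (up_ren (up_ren r))) D)"
  "ren r (subst (scons b (scons a Var)) g) =
    subst (scons (ren r b) (scons (ren r a) Var)) (ren (up_ren (up_ren r)) g)"
  unfolding inst_def inst3_def ren_subst subst_ren
  by (rule subst_eqI; simp add: scons_case up_ren_case numeral_eq_Suc split: nat.split)+

lemma ren_shift:
  "ren (up_ren r) (shift (Suc 0) A) = shift (Suc 0) (ren r A)"
  "ren (up_ren (up_ren r)) (shift 2 A) = shift 2 (ren r A)"
  by (simp_all add: calc)

lemma ren_types:
  "ren r (funext_type i) = funext_type i"
  "ren r (univalence_type i) = univalence_type i"
  by (simp_all add: funext_type_def univalence_type_def is_equiv_def happly_def id_to_equiv_def
    Equiv_def id_equiv_def arr_def times_def Let_def calc)

definition stable_typing :: "ctx \<Rightarrow> tm \<Rightarrow> tm \<Rightarrow> bool" where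
  "stable_typing G a A \<longleftrightarrow> renamable_ctx G \<and> renamable G a A"

definition stable_eq :: "ctx \<Rightarrow> tm \<Rightarrow> tm \<Rightarrow> tm \<Rightarrow> bool" where
  "stable_eq G a b A \<longleftrightarrow> renamable_ctx G \<and> renamable_eq G a b A"

lemma stableI:
  "renamable_ctx G \<Longrightarrow> (\<And>D r. renaming D r G \<Longrightarrow> D \<turnstile> ren r a \<Colon> ren r A) \<Longrightarrow> stable_typing G a A"
  "renamable_ctx G \<Longrightarrow> (\<And>D r. renaming D r G \<Longrightarrow> D \<turnstile> ren r a \<doteq> ren r b \<Colon> ren r A) \<Longrightarrow> stable_eq G a b A"
  by (auto simp: stable_typing_def stable_eq_def renamable_def renamable_eq_def)

lemma stable_ctx:
  "stable_typing G a A \<Longrightarrow> renamable_ctx G" "stable_eq G a b A \<Longrightarrow> renamable_ctx G"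
  by (auto simp: stable_typing_def stable_eq_def)

lemma stableD:
  "stable_typing G a A \<Longrightarrow> renaming D r G \<Longrightarrow> D \<turnstile> ren r a \<Colon> ren r A"
  "stable_eq G a b A \<Longrightarrow> renaming D r G \<Longrightarrow> D \<turnstile> ren r a \<doteq> ren r b \<Colon> ren r A"
  by (auto simp: stable_typing_def stable_eq_def renamable_def renamable_eq_def)

lemma renaming_ext2:
  "renamable_ctx (B # A # G) \<Longrightarrow> renaming D r G \<Longrightarrow>
    renaming (ren (up_ren r) B # ren r A # D) (up_ren (up_ren r)) (B # A # G)"
  by (meson renamable_ctx.simps(2) renaming_ext)

lemma renaming_ext3:
  "renamable_ctx (C # B # A # G) \<Longrightarrow> renaming D r G \<Longrightarrow>
    renaming (ren (up_ren (up_ren r)) C # ren (up_ren r) B # ren r A # D)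
      (up_ren (up_ren (up_ren r))) (C # B # A # G)"
  by (meson renamable_ctx.simps(2) renaming_ext)

text \<open>
  A hypothesis about an extended context can be used for any renaming of the unextended one, because
  it contains what \<open>renaming_ext\<close> needs to lift the renaming.  The three lemmas serve rules that
  bind one, two and three variables.
\<close>
lemma stableD1:
  "stable_typing (A # G) b B \<Longrightarrow> renaming D r G \<Longrightarrow> ren r A # D \<turnstile> ren (up_ren r) b \<Colon> ren (up_ren r) B"
  "stable_eq (A # G) b c B \<Longrightarrow> renaming D r G
    \<Longrightarrow> ren r A # D \<turnstile> ren (up_ren r) b \<doteq> ren (up_ren r) c \<Colon> ren (up_ren r) B"
  by (blast intro: stableD stable_ctx renaming_ext)+

lemma stableD2:
  "stable_typing (A' # A # G) b B \<Longrightarrow> renaming D r G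
    \<Longrightarrow> ren (up_ren r) A' # ren r A # D \<turnstile> ren (up_ren (up_ren r)) b \<Colon> ren (up_ren (up_ren r)) B"
  "stable_eq (A' # A # G) b c B \<Longrightarrow> renaming D r G
    \<Longrightarrow> ren (up_ren r) A' # ren r A # D
      \<turnstile> ren (up_ren (up_ren r)) b \<doteq> ren (up_ren (up_ren r)) c \<Colon> ren (up_ren (up_ren r)) B"
  by (blast intro: stableD stable_ctx renaming_ext2)+

lemma stableD3:
  "stable_typing (A'' # A' # A # G) b B \<Longrightarrow> renaming D r G
    \<Longrightarrow> ren (up_ren (up_ren r)) A'' # ren (up_ren r) A' # ren r A # D
      \<turnstile> ren (up_ren (up_ren (up_ren r))) b \<Colon> ren (up_ren (up_ren (up_ren r))) B"
  "stable_eq (A'' # A' # A # G) b c B \<Longrightarrow> renaming D r G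
    \<Longrightarrow> ren (up_ren (up_ren r)) A'' # ren (up_ren r) A' # ren r A # D
      \<turnstile> ren (up_ren (up_ren (up_ren r))) b \<doteq> ren (up_ren (up_ren (up_ren r))) c
        \<Colon> ren (up_ren (up_ren (up_ren r))) B"
  by (blast intro: stableD stable_ctx renaming_ext3)+

lemma stable_ctx_tail:
  "stable_typing (A # G) b B \<Longrightarrow> renamable_ctx G" "stable_eq (A # G) b c B \<Longrightarrow> renamable_ctx G"
  by (auto simp: stable_typing_def stable_eq_def)

lemma renaming_Var:
  assumes "renaming D r G" "n < length G"
  shows "D \<turnstile> Var (r n) \<Colon> ren r (shift (Suc n) (G ! n))"
proof -
  have "D \<turnstile> Var (r n) \<Colon> shift (Suc (r n)) (D ! r n)"
    using assms by (intro Var) (auto simp: renaming_def)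
  then show ?thesis using assms by (simp add: renaming_def)
qed

lemma renaming_wf: "renaming D r G \<Longrightarrow> wf_ctx D"
  by (simp add: renaming_def)

text \<open>
  The rules for the two judgements all have the same proof: use the induction hypotheses on \<open>r\<close> and its lifts, push the
  renaming through the instantiations in the rule, and apply the same rule to the results.
\<close>
lemma renaming_stable:
  "wf_ctx G \<Longrightarrow> renamable_ctx G"
  "G \<turnstile> a \<Colon> A \<Longrightarrow> stable_typing G a A"
  "G \<turnstile> a \<doteq> b \<Colon> A \<Longrightarrow> stable_eq G a b A"
  apply (induction rule: wf_ctx_typing_judg_eq.inducts)
  apply (simp; fail)
  apply (auto simp: stable_typing_def)[1]
  apply ((rule stableI, (assumption | (drule (1) stable_ctx stable_ctx_tail, assumption) | (erule stable_ctx stable_ctx_tail))),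
     ((drule (1) stableD | drule (1) stableD1 | drule (1) stableD2 | drule (1) stableD3)+)?,
     (simp only: ren.simps ren_inst ren_shift ren_types up_ren.simps One_nat_def)?,
     ((rule wf_ctx_typing_judg_eq.intros[unfolded One_nat_def] renaming_Var; (assumption | erule renaming_wf)); fail))+
  done

section \<open>Weakening and closed terms\<close>

lemma renamable_ctx_wf: "renamable_ctx G \<Longrightarrow> wf_ctx G"
proof (induction G)
  case (Cons A G)
  then have "renaming G (\<lambda>n. n) G"
    by (simp add: renaming_def ren_id)
  with Cons show ?case
    by (metis renamable_def ren_id ctx_ext renamable_ctx.simps(2))
qed (rule ctx_emp)

lemma typing_wf: "G \<turnstile> a \<Colon> A \<Longrightarrow> wf_ctx G"
  and judg_eq_wf: "G \<turnstile> a \<doteq> b \<Colon> A \<Longrightarrow> wf_ctx G"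
  by (blast intro: renamable_ctx_wf stable_ctx renaming_stable)+

lemma renaming_Suc: "wf_ctx (B # G) \<Longrightarrow> renaming (B # G) Suc G"
  by (simp add: renaming_def calc)

lemma weaken:
  assumes "wf_ctx (B # G)"
  shows "G \<turnstile> a \<Colon> A \<Longrightarrow> B # G \<turnstile> ren Suc a \<Colon> ren Suc A"
  by (blast intro: stableD renaming_stable renaming_Suc assms)

text \<open>
  Stated by the effect of substitution, because this is how it is used; it says that only the first
  \<open>n\<close> variables occur free.
\<close>
definition scoped :: "nat \<Rightarrow> tm \<Rightarrow> bool" where
  "scoped n t \<longleftrightarrow> (\<forall>s. (\<forall>k < n. s k = Var k) \<longrightarrow> subst s t = t)"

text \<open>
  As for renaming, the type annotation of a \<open>\<lambda>\<close> is reached through the context of the premise.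
\<close>
primrec scoped_ctx :: "ctx \<Rightarrow> bool" where
  "scoped_ctx [] \<longleftrightarrow> True"
| "scoped_ctx (A # G) \<longleftrightarrow> scoped (length G) A \<and> scoped_ctx G"

lemma up_fixes: "\<forall>k < n. s k = Var k \<Longrightarrow> \<forall>k < Suc n. up s k = Var k"
  by (auto simp: less_Suc_eq_0_disj up_0 up_Suc)

lemma typing_scoped:
  "wf_ctx G \<Longrightarrow> scoped_ctx G"
  "G \<turnstile> a \<Colon> A \<Longrightarrow> scoped_ctx G \<and> scoped (length G) a"
  "G \<turnstile> a \<doteq> b \<Colon> A \<Longrightarrow> True"
  by (induction rule: wf_ctx_typing_judg_eq.inducts) (simp_all add: scoped_def up_fixes, (metis up_fixes)+)

lemma closed_subst: "[] \<turnstile> a \<Colon> A \<Longrightarrow> subst s a = a"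
  using typing_scoped(2)[of "[]" a A] by (simp add: scoped_def)

lemma closed_ren: "[] \<turnstile> a \<Colon> A \<Longrightarrow> ren r a = a"
  by (simp add: ren_as_subst closed_subst)

lemma weaken_closed: "[] \<turnstile> a \<Colon> A \<Longrightarrow> wf_ctx G \<Longrightarrow> G \<turnstile> a \<Colon> ren r A"
  using stableD(1)[OF renaming_stable(2), of "[]" a A G r] by (simp add: closed_ren renaming_def)

section \<open>Functions and pairs\<close>

lemma Var0: "wf_ctx (A # G) \<Longrightarrow> A # G \<turnstile> Var 0 \<Colon> ren Suc A"
  using Var[of "A # G" 0] by (simp add: calc)

lemma VarS: "wf_ctx (A # G) \<Longrightarrow> G \<turnstile> Var n \<Colon> B \<Longrightarrow> A # G \<turnstile> Var (Suc n) \<Colon> ren Suc B"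
  using weaken[of A G "Var n" B] by simp

lemma arr_form: "G \<turnstile> A \<Colon> U i \<Longrightarrow> G \<turnstile> B \<Colon> U i \<Longrightarrow> G \<turnstile> A \<rightharpoondown> B \<Colon> U i"
  unfolding arr_def shift_def using weaken[of A G B "U i"] ctx_ext[of G A i]
  by (auto intro!: Pi_form)

lemma times_form: "G \<turnstile> A \<Colon> U i \<Longrightarrow> G \<turnstile> B \<Colon> U i \<Longrightarrow> G \<turnstile> A \<otimes> B \<Colon> U i"
  unfolding times_def shift_def using weaken[of A G B "U i"] ctx_ext[of G A i]
  by (auto intro!: Sig_form)

lemma arr_elim: "G \<turnstile> f \<Colon> A \<rightharpoondown> B \<Longrightarrow> G \<turnstile> a \<Colon> A \<Longrightarrow> G \<turnstile> f \<cdot> a \<Colon> B"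
  using Pi_elim[of G f A "shift 1 B" a] by (simp add: arr_def calc)

lemma arr_elim_eq:
  "G \<turnstile> f \<doteq> f' \<Colon> A \<rightharpoondown> B \<Longrightarrow> G \<turnstile> a \<doteq> a' \<Colon> A \<Longrightarrow> G \<turnstile> f \<cdot> a \<doteq> f' \<cdot> a' \<Colon> B"
  using Pi_elim_eq[of G f f' A "shift 1 B" a a'] by (simp add: arr_def calc)

lemma ren_arr: "ren r (A \<rightharpoondown> B) = ren r A \<rightharpoondown> ren r B"
  and subst_arr: "subst s (A \<rightharpoondown> B) = subst s A \<rightharpoondown> subst s B"
  and ren_times: "ren r (A \<otimes> B) = ren r A \<otimes> ren r B"
  and subst_times: "subst s (A \<otimes> B) = subst s A \<otimes> subst s B"
  by (simp_all add: arr_def times_def calc)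

lemma is_equiv_ren: "ren r (is_equiv A B f) = is_equiv (ren r A) (ren r B) (ren r f)"
  and is_equiv_subst: "subst s (is_equiv A B f) = is_equiv (subst s A) (subst s B) (subst s f)"
  by (simp_all add: is_equiv_def ren_arr subst_arr ren_times subst_times calc)

lemma happly_ren: "ren r (happly A B f g) = happly (ren r A) (ren r B) (ren r f) (ren r g)"
  and happly_subst: "subst s (happly A B f g) = happly (subst s A) (subst s B) (subst s f) (subst s g)"
  by (simp_all add: happly_def calc)

lemmas calc_equiv = calc ren_arr subst_arr ren_times subst_times is_equiv_ren is_equiv_subst
  happly_ren happly_subst

lemma arr_intro: "A # G \<turnstile> b \<Colon> ren Suc B \<Longrightarrow> G \<turnstile> Lam A b \<Colon> A \<rightharpoondown> B"
  using Pi_intro[of A G b "ren Suc B"] by (simp add: arr_def shift_def)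

lemma weaken_U: "G \<turnstile> A \<Colon> U i \<Longrightarrow> wf_ctx (B # G) \<Longrightarrow> B # G \<turnstile> ren Suc A \<Colon> U i"
  using weaken[of B G A "U i"] by simp

lemma weaken_arr:
  "G \<turnstile> f \<Colon> A \<rightharpoondown> B \<Longrightarrow> wf_ctx (C # G) \<Longrightarrow> C # G \<turnstile> ren Suc f \<Colon> ren Suc A \<rightharpoondown> ren Suc B"
  using weaken[of C G f "A \<rightharpoondown> B"] by (simp add: ren_arr)

lemma weaken_family:
  "G \<turnstile> P \<Colon> A \<rightharpoondown> U i \<Longrightarrow> wf_ctx (C # G) \<Longrightarrow> C # G \<turnstile> ren Suc P \<Colon> ren Suc A \<rightharpoondown> U i"
  using weaken_arr[of G P A "U i" C] by simp

text \<open>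
  Elimination into a type that does not depend on the pair; no congruence of types is involved, in
  contrast to the dependent second projection.
\<close>
lemma Sig_rec:
  assumes "G \<turnstile> A \<Colon> U i" "A # G \<turnstile> B \<Colon> U i" "G \<turnstile> C \<Colon> U j"
    and g: "B # A # G \<turnstile> g \<Colon> ren (\<lambda>n. Suc (Suc n)) C" and p: "G \<turnstile> p \<Colon> Sig A B"
  shows "G \<turnstile> IndSig (ren Suc C) g p \<Colon> C"
proof -
  have "Sig A B # G \<turnstile> ren Suc C \<Colon> U j"
    by (rule weaken_U[OF assms(3)]) (rule ctx_ext, rule Sig_form, fact+)
  then have "G \<turnstile> IndSig (ren Suc C) g p \<Colon> inst 0 p (ren Suc C)"
    by (rule Sig_elim) (use g p in \<open>simp_all add: calc\<close>)
  then show ?thesis by (simp add: calc)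
qed

lemma Sig_fst:
  assumes "G \<turnstile> A \<Colon> U i" "A # G \<turnstile> B \<Colon> U i" "G \<turnstile> p \<Colon> Sig A B"
  shows "G \<turnstile> IndSig (ren Suc A) (Var 1) p \<Colon> A"
proof (rule Sig_rec[OF assms(1,2,1) _ assms(3)])
  have "A # G \<turnstile> Var 0 \<Colon> ren Suc A"
    by (rule Var0[OF ctx_ext[OF assms(1)]])
  then show "B # A # G \<turnstile> Var 1 \<Colon> ren (\<lambda>n. Suc (Suc n)) A"
    using VarS[OF ctx_ext[OF assms(2)], of 0 "ren Suc A"] by (simp add: calc)
qed

section \<open>Equivalences\<close>

definition inverse_law :: "tm \<Rightarrow> tm \<Rightarrow> tm \<Rightarrow> tm" where
  "inverse_law B f g = Pi B (Id (ren Suc B) (ren Suc f \<cdot> (ren Suc g \<cdot> Var 0)) (Var 0))"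

lemma inverse_law_subst:
  "subst s (inverse_law B f g) = inverse_law (subst s B) (subst s f) (subst s g)"
  by (simp_all add: inverse_law_def calc)

lemma is_equiv_alt:
  "is_equiv A B f =
    Sig (B \<rightharpoondown> A) (inverse_law (ren Suc B) (ren Suc f) (Var 0)) \<otimes>
    Sig (B \<rightharpoondown> A) (inverse_law (ren Suc A) (Var 0) (ren Suc f))"
  by (simp add: is_equiv_def inverse_law_def calc)

lemma inverse_law_form:
  assumes "G \<turnstile> A \<Colon> U i" "G \<turnstile> B \<Colon> U i" "G \<turnstile> f \<Colon> A \<rightharpoondown> B" "G \<turnstile> g \<Colon> B \<rightharpoondown> A"
  shows "G \<turnstile> inverse_law B f g \<Colon> U i"
  unfolding inverse_law_def
  using ctx_ext[OF assms(2)] assms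
  by (intro Pi_form Id_form) (auto intro: Var0 weaken_U arr_elim weaken_arr)

lemma is_equiv_parts:
  assumes "G \<turnstile> A \<Colon> U i" "G \<turnstile> B \<Colon> U i" "G \<turnstile> f \<Colon> A \<rightharpoondown> B"
  shows "(B \<rightharpoondown> A) # G \<turnstile> inverse_law (ren Suc B) (ren Suc f) (Var 0) \<Colon> U i"
    and "(B \<rightharpoondown> A) # G \<turnstile> inverse_law (ren Suc A) (Var 0) (ren Suc f) \<Colon> U i"
    and "G \<turnstile> B \<rightharpoondown> A \<Colon> U i"
proof -
  show BA: "G \<turnstile> B \<rightharpoondown> A \<Colon> U i"
    by (rule arr_form) fact+
  note wf = ctx_ext[OF BA]
  have "(B \<rightharpoondown> A) # G \<turnstile> Var 0 \<Colon> ren Suc B \<rightharpoondown> ren Suc A"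
    using Var0[OF wf] by (simp add: ren_arr)
  note 1 = this weaken_U[OF assms(1) wf] weaken_U[OF assms(2) wf] weaken_arr[OF assms(3) wf]
  show "(B \<rightharpoondown> A) # G \<turnstile> inverse_law (ren Suc B) (ren Suc f) (Var 0) \<Colon> U i"
    by (rule inverse_law_form) (fact 1)+
  show "(B \<rightharpoondown> A) # G \<turnstile> inverse_law (ren Suc A) (Var 0) (ren Suc f) \<Colon> U i"
    by (rule inverse_law_form) (fact 1)+
qed

lemma is_equiv_form:
  assumes "G \<turnstile> A \<Colon> U i" "G \<turnstile> B \<Colon> U i" "G \<turnstile> f \<Colon> A \<rightharpoondown> B"
  shows "G \<turnstile> is_equiv A B f \<Colon> U i"
  unfolding is_equiv_alt using is_equiv_parts[OF assms]
  by (intro times_form Sig_form) auto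

lemma times_intro: "G \<turnstile> A \<Colon> U i \<Longrightarrow> G \<turnstile> B \<Colon> U i \<Longrightarrow> G \<turnstile> a \<Colon> A \<Longrightarrow> G \<turnstile> b \<Colon> B \<Longrightarrow> G \<turnstile> Pair a b \<Colon> A \<otimes> B"
  unfolding times_def shift_def
  using weaken_U[of G B i A] ctx_ext[of G A i]
  by (intro Sig_intro[of _ _ _ i]) (auto simp: calc)

lemma is_equiv_intro:
  assumes ty: "G \<turnstile> A \<Colon> U i" "G \<turnstile> B \<Colon> U i" "G \<turnstile> f \<Colon> A \<rightharpoondown> B"
    and "G \<turnstile> g \<Colon> B \<rightharpoondown> A" "G \<turnstile> p \<Colon> inverse_law B f g" "G \<turnstile> h \<Colon> B \<rightharpoondown> A" "G \<turnstile> q \<Colon> inverse_law A h f"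
  shows "G \<turnstile> Pair (Pair g p) (Pair h q) \<Colon> is_equiv A B f"
  unfolding is_equiv_alt
  using is_equiv_parts[OF ty] assms
  by (intro times_intro[of _ _ i] Sig_intro[of _ _ _ i] Sig_form) (auto simp: calc inverse_law_subst)

text \<open>
  The first projection of the first component; all that will be needed of an equivalence given by an
  axiom or by the structure of a modality.
\<close>
lemma is_equiv_inverse:
  assumes "G \<turnstile> A \<Colon> U i" "G \<turnstile> B \<Colon> U i" "G \<turnstile> f \<Colon> A \<rightharpoondown> B" "G \<turnstile> p \<Colon> is_equiv A B f"
  shows "\<exists>g. G \<turnstile> g \<Colon> B \<rightharpoondown> A"
proof -
  note parts = is_equiv_parts[OF assms(1-3)]
  have S: "G \<turnstile> Sig (B \<rightharpoondown> A) (inverse_law (ren Suc B) (ren Suc f) (Var 0)) \<Colon> U i"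
    "G \<turnstile> Sig (B \<rightharpoondown> A) (inverse_law (ren Suc A) (Var 0) (ren Suc f)) \<Colon> U i"
    using parts by (auto intro: Sig_form)
  have "\<exists>q. G \<turnstile> q \<Colon> Sig (B \<rightharpoondown> A) (inverse_law (ren Suc B) (ren Suc f) (Var 0))"
    using Sig_fst[OF S(1) weaken_U[OF S(2) ctx_ext[OF S(1)]]] assms(4)
    unfolding is_equiv_alt times_def shift_def by auto
  then show ?thesis
    using Sig_fst[OF parts(3,1)] by blast
qed

section \<open>Function extensionality\<close>

definition homotopy :: "tm \<Rightarrow> tm \<Rightarrow> tm \<Rightarrow> tm \<Rightarrow> tm" where
  "homotopy A B f g = Pi A (Id (ren Suc B \<cdot> Var 0) (ren Suc f \<cdot> Var 0) (ren Suc g \<cdot> Var 0))"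

lemma homotopy_ren: "ren r (homotopy A B f g) = homotopy (ren r A) (ren r B) (ren r f) (ren r g)"
  and homotopy_subst:
    "subst s (homotopy A B f g) = homotopy (subst s A) (subst s B) (subst s f) (subst s g)"
  by (simp_all add: homotopy_def calc)

lemma weaken_Pi:
  "G \<turnstile> f \<Colon> Pi A (ren Suc B \<cdot> Var 0) \<Longrightarrow> wf_ctx (C # G)
    \<Longrightarrow> C # G \<turnstile> ren Suc f \<Colon> Pi (ren Suc A) (ren Suc (ren Suc B) \<cdot> Var 0)"
  using weaken[of C G f "Pi A (ren Suc B \<cdot> Var 0)"] by (simp add: calc)

lemma family_elim: "G \<turnstile> f \<Colon> Pi A (ren Suc B \<cdot> Var 0) \<Longrightarrow> G \<turnstile> a \<Colon> A \<Longrightarrow> G \<turnstile> f \<cdot> a \<Colon> B \<cdot> a"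
  using Pi_elim[of G f A "ren Suc B \<cdot> Var 0" a] by (simp add: calc)

lemma family_body:
  assumes "G \<turnstile> A \<Colon> U i" "G \<turnstile> B \<Colon> A \<rightharpoondown> U i"
  shows "A # G \<turnstile> ren Suc B \<cdot> Var 0 \<Colon> U i"
  using arr_elim[OF weaken_family[OF assms(2) ctx_ext[OF assms(1)]] Var0[OF ctx_ext[OF assms(1)]]]
  by simp

lemma homotopy_form:
  assumes "G \<turnstile> A \<Colon> U i" "G \<turnstile> B \<Colon> A \<rightharpoondown> U i"
    "G \<turnstile> f \<Colon> Pi A (ren Suc B \<cdot> Var 0)" "G \<turnstile> g \<Colon> Pi A (ren Suc B \<cdot> Var 0)"
  shows "G \<turnstile> homotopy A B f g \<Colon> U i"
  unfolding homotopy_def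
  using assms family_body[OF assms(1,2)] ctx_ext[OF assms(1)]
  by (intro Pi_form Id_form family_elim) (auto intro: Var0 weaken_Pi)

lemma happly_induction:
  assumes A: "G \<turnstile> A \<Colon> U i" and B: "G \<turnstile> B \<Colon> A \<rightharpoondown> U i"
    and f: "G \<turnstile> f \<Colon> Pi A (ren Suc B \<cdot> Var 0)" and g: "G \<turnstile> g \<Colon> Pi A (ren Suc B \<cdot> Var 0)"
    and p: "G \<turnstile> p \<Colon> Id (Pi A (ren Suc B \<cdot> Var 0)) f g"
  shows "G \<turnstile> IndId (homotopy (shift 3 A) (shift 3 B) (Var 2) (Var 1))
    (Lam (ren Suc A) (Refl (Var 1 \<cdot> Var 0))) f g p \<Colon> homotopy A B f g"
proof -
  let ?T = "Pi A (ren Suc B \<cdot> Var 0)"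
  have T: "G \<turnstile> ?T \<Colon> U i"
    by (intro Pi_form A family_body B)
  note wf1 = ctx_ext[OF T]
  note v1 = Var0[OF wf1]
  note T1 = weaken_U[OF T wf1]
  note A1 = weaken_U[OF A wf1]
  note B1 = weaken_family[OF B wf1]
  note wf2 = ctx_ext[OF T1]
  note v2 = Var0[OF wf2] VarS[OF wf2 v1]
  note T2 = weaken_U[OF T1 wf2]
  note A2 = weaken_U[OF A1 wf2]
  note B2 = weaken_family[OF B1 wf2]
  have Id2: "ren Suc ?T # ?T # G \<turnstile> Id (shift 2 ?T) (Var 1) (Var 0) \<Colon> U i"
    using Id_form[OF T2 v2(2,1)] by (simp add: calc)
  note wf3 = ctx_ext[OF Id2]
  note v3 = VarS[OF wf3 v2(1)] VarS[OF wf3 v2(2)]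
  note A3 = weaken_U[OF A2 wf3]
  note B3 = weaken_family[OF B2 wf3]
  have C: "Id (shift 2 ?T) (Var 1) (Var 0) # shift 1 ?T # ?T # G
      \<turnstile> homotopy (shift 3 A) (shift 3 B) (Var 2) (Var 1) \<Colon> U i"
    using homotopy_form[OF A3, of "shift 3 B" "Var 2" "Var 1"] B3 v3 by (simp add: calc)
  note wfA = ctx_ext[OF A1]
  have "ren Suc A # ?T # G \<turnstile> Var 1 \<Colon> Pi (ren Suc (ren Suc A)) (ren Suc (ren Suc (ren Suc B)) \<cdot> Var 0)"
    using VarS[OF wfA v1] by (simp add: calc)
  then have "ren Suc A # ?T # G \<turnstile> Var 1 \<cdot> Var 0 \<Colon> ren Suc (ren Suc B) \<cdot> Var 0"
    by (rule family_elim) (rule Var0[OF wfA])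
  then have "ren Suc A # ?T # G \<turnstile> Refl (Var 1 \<cdot> Var 0)
      \<Colon> Id (ren Suc (ren Suc B) \<cdot> Var 0) (Var 1 \<cdot> Var 0) (Var 1 \<cdot> Var 0)"
    by (rule Id_intro[OF family_body, rotated -1]) (use A1 B1 in simp_all)
  from Pi_intro[OF this]
  have c: "?T # G \<turnstile> Lam (ren Suc A) (Refl (Var 1 \<cdot> Var 0))
      \<Colon> inst3 1 (Var 0) (Var 0) (Refl (Var 0)) (homotopy (shift 3 A) (shift 3 B) (Var 2) (Var 1))"
    by (simp add: homotopy_def calc)
  from Id_elim[OF C c f g p] show ?thesis
    by (simp add: homotopy_subst calc)
qed

text \<open>
  Without a derivation for \<open>happly\<close>, the type of \<open>FunExt\<close> cannot be projected from, since the projection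
  needs the type of the axiom to be well formed.
\<close>
lemma happly_typing:
  assumes A: "G \<turnstile> A \<Colon> U i" and B: "G \<turnstile> B \<Colon> A \<rightharpoondown> U i"
    and f: "G \<turnstile> f \<Colon> Pi A (ren Suc B \<cdot> Var 0)" and g: "G \<turnstile> g \<Colon> Pi A (ren Suc B \<cdot> Var 0)"
  shows "G \<turnstile> happly A B f g \<Colon> Id (Pi A (ren Suc B \<cdot> Var 0)) f g \<rightharpoondown> homotopy A B f g"
proof -
  have I: "G \<turnstile> Id (Pi A (ren Suc B \<cdot> Var 0)) f g \<Colon> U i"
    by (intro Id_form Pi_form f g A B family_body)
  note wf = ctx_ext[OF I]
  have *: "Id (Pi A (ren Suc B \<cdot> Var 0)) f g # G \<turnstile> Var 0 
      \<Colon> Id (Pi (ren Suc A) (ren Suc (ren Suc B) \<cdot> Var 0)) (ren Suc f) (ren Suc g)"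
    using Var0[OF wf] by (simp add: calc)
  have "Id (Pi A (ren Suc B \<cdot> Var 0)) f g # G
      \<turnstile> IndId (homotopy (shift 3 (ren Suc A)) (shift 3 (ren Suc B)) (Var 2) (Var 1))
          (Lam (ren Suc (ren Suc A)) (Refl (Var 1 \<cdot> Var 0))) (ren Suc f) (ren Suc g) (Var 0)
      \<Colon> ren Suc (homotopy A B f g)"
    unfolding homotopy_ren
    by (rule happly_induction[OF weaken_U[OF A wf] weaken_family[OF B wf] weaken_Pi[OF f wf]
        weaken_Pi[OF g wf] *])
  from arr_intro[OF this] show ?thesis
    by (simp add: happly_def homotopy_def calc)
qed

lemma FunExt_typing:
  assumes A: "G \<turnstile> A \<Colon> U i" and B: "G \<turnstile> B \<Colon> A \<rightharpoondown> U i"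
    and f: "G \<turnstile> f \<Colon> Pi A (ren Suc B \<cdot> Var 0)" and g: "G \<turnstile> g \<Colon> Pi A (ren Suc B \<cdot> Var 0)"
  shows "G \<turnstile> FunExt i \<cdot> A \<cdot> B \<cdot> f \<cdot> g
    \<Colon> is_equiv (Id (Pi A (ren Suc B \<cdot> Var 0)) f g) (homotopy A B f g) (happly A B f g)"
proof -
  from FunExt[OF typing_wf[OF A], of i] have "G \<turnstile> FunExt i \<Colon> funext_type i" .
  from Pi_elim[OF this[unfolded funext_type_def] A]
  have 1: "G \<turnstile> FunExt i \<cdot> A \<Colon> Pi (A \<rightharpoondown> U i)
      (Pi (Pi (ren Suc A) (Var 1 \<cdot> Var 0)) (Pi (Pi (ren (\<lambda>n. Suc (Suc n)) A) (Var 2 \<cdot> Var 0))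
        (is_equiv
          (Id (Pi (shift 3 A) (Var 3 \<cdot> Var 0)) (Var 1) (Var 0))
          (homotopy (shift 3 A) (Var 2) (Var 1) (Var 0))
          (happly (shift 3 A) (Var 2) (Var 1) (Var 0)))))"
    by (simp add: calc_equiv homotopy_def)
  from Pi_elim[OF this B]
  have 2: "G \<turnstile> FunExt i \<cdot> A \<cdot> B \<Colon>
      Pi (Pi A (ren Suc B \<cdot> Var 0)) (Pi (Pi (ren Suc A) (ren Suc (ren Suc B) \<cdot> Var 0))
        (is_equiv
          (Id (Pi (shift 2 A) (shift 3 B \<cdot> Var 0)) (Var 1) (Var 0))
          (homotopy (shift 2 A) (shift 2 B) (Var 1) (Var 0))
          (happly (shift 2 A) (shift 2 B) (Var 1) (Var 0))))"
    by (simp add: calc_equiv homotopy_def)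
  from Pi_elim[OF this f]
  have 3: "G \<turnstile> FunExt i \<cdot> A \<cdot> B \<cdot> f \<Colon>
      Pi (Pi A (ren Suc B \<cdot> Var 0))
        (is_equiv
          (Id (Pi (shift 1 A) (shift 2 B \<cdot> Var 0)) (shift 1 f) (Var 0))
          (homotopy (shift 1 A) (shift 1 B) (shift 1 f) (Var 0))
          (happly (shift 1 A) (shift 1 B) (shift 1 f) (Var 0)))"
    by (simp add: calc_equiv homotopy_def)
  from Pi_elim[OF this g] show ?thesis
    by (simp add: calc_equiv homotopy_def)
qed

text \<open>
  The axiom speaks of families \<open>B : A \<rightarrow> U\<close>, whereas product types have an open term \<open>T\<close> as codomain; the
  two presentations are exchanged by this reduction.
\<close>
lemma beta_body:
  assumes "G \<turnstile> A \<Colon> U i" "A # G \<turnstile> T \<Colon> B"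
  shows "A # G \<turnstile> ren Suc (Lam A T) \<cdot> Var 0 \<doteq> T \<Colon> B"
proof -
  note wf = ctx_ext[OF assms(1)]
  have id: "inst 0 (Var 0) (ren (up_ren Suc) t) = t" for t
  proof -
    have "(\<lambda>n. scons (Var 0) Var (up_ren Suc n)) = Var"
      by (rule ext, rename_tac n, case_tac n) auto
    then show ?thesis by (simp add: calc)
  qed
  have "ren Suc A # A # G \<turnstile> ren (up_ren Suc) T \<Colon> ren (up_ren Suc) B"
    by (rule stableD1(1)[OF renaming_stable(2)[OF assms(2)] renaming_Suc[OF wf]])
  from Pi_comp[OF this Var0[OF wf]] show ?thesis
    by (simp add: id)
qed

lemma funext:
  assumes A: "G \<turnstile> A \<Colon> U i" and T: "A # G \<turnstile> T \<Colon> U i"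
    and f: "G \<turnstile> f \<Colon> Pi A T" and g: "G \<turnstile> g \<Colon> Pi A T"
    and h: "A # G \<turnstile> h \<Colon> Id T (ren Suc f \<cdot> Var 0) (ren Suc g \<cdot> Var 0)"
  shows "\<exists>t. G \<turnstile> t \<Colon> Id (Pi A T) f g"
proof -
  let ?B = "Lam A T"
  let ?BA = "ren Suc ?B \<cdot> Var 0"
  have B: "G \<turnstile> ?B \<Colon> A \<rightharpoondown> U i"
    by (rule arr_intro) (simp add: T)
  have eq: "A # G \<turnstile> ?BA \<doteq> T \<Colon> U i"
    by (rule beta_body[OF A T])
  have eqPi: "G \<turnstile> Pi A ?BA \<doteq> Pi A T \<Colon> U i"
    by (intro Pi_form_eq A eq eq_refl[OF A])
  have f': "G \<turnstile> f \<Colon> Pi A ?BA" and g': "G \<turnstile> g \<Colon> Pi A ?BA"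
    by (rule conv[OF f eq_sym[OF eqPi]], rule conv[OF g eq_sym[OF eqPi]])
  note wf = ctx_ext[OF A]
  have ap: "A # G \<turnstile> ren Suc f \<cdot> Var 0 \<Colon> ?BA" if "G \<turnstile> f \<Colon> Pi A ?BA" for f
    by (rule family_elim[OF weaken_Pi[OF that wf] Var0[OF wf]])
  have "A # G \<turnstile> Id T (ren Suc f \<cdot> Var 0) (ren Suc g \<cdot> Var 0)
      \<doteq> Id ?BA (ren Suc f \<cdot> Var 0) (ren Suc g \<cdot> Var 0) \<Colon> U i"
    by (rule eq_sym) (intro Id_form_eq eq eq_refl ap f' g')
  then have "A # G \<turnstile> h \<Colon> Id ?BA (ren Suc f \<cdot> Var 0) (ren Suc g \<cdot> Var 0)"
    by (rule conv[OF h])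
  then have hom: "G \<turnstile> Lam A h \<Colon> homotopy A ?B f g"
    unfolding homotopy_def by (rule Pi_intro)
  have "G \<turnstile> Id (Pi A ?BA) f g \<Colon> U i"
    by (intro Id_form Pi_form A f' g' family_body B)
  then obtain k where "G \<turnstile> k \<Colon> homotopy A ?B f g \<rightharpoondown> Id (Pi A ?BA) f g"
    using is_equiv_inverse[OF _ homotopy_form[OF A B f' g'] happly_typing[OF A B f' g']
      FunExt_typing[OF A B f' g']] by auto
  from arr_elim[OF this hom] have "G \<turnstile> k \<cdot> Lam A h \<Colon> Id (Pi A ?BA) f g" .
  moreover have "G \<turnstile> Id (Pi A ?BA) f g \<doteq> Id (Pi A T) f g \<Colon> U i"
    by (intro Id_form_eq eqPi eq_refl f' g')
  ultimately show ?thesis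
    by (blast intro: conv)
qed

section \<open>Modal operators and units\<close>

text \<open>
  Derivability of an operator and a unit, bundled since they are weakened together throughout.
\<close>
definition modal_data :: "nat \<Rightarrow> ctx \<Rightarrow> tm \<Rightarrow> tm \<Rightarrow> bool" where
  "modal_data i G M e \<longleftrightarrow> G \<turnstile> M \<Colon> operator_type i \<and> G \<turnstile> e \<Colon> unit_type i M"

definition restriction :: "tm \<Rightarrow> tm \<Rightarrow> tm \<Rightarrow> tm \<Rightarrow> tm" where
  "restriction M e A P =
    Lam (modal_family M A P) (Lam (ren Suc A) (Var 1 \<cdot> (shift 2 e \<cdot> shift 2 A \<cdot> Var 0)))"

lemma modal_ren:
  "ren r (operator_type i) = operator_type i"
  "ren r (unit_type i M) = unit_type i (ren r M)"
  "ren r (modal_family M A P) = modal_family (ren r M) (ren r A) (ren r P)"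
  "ren r (modal_sections M A P f) = modal_sections (ren r M) (ren r A) (ren r P) (ren r f)"
  "ren r (is_modal M e A) = is_modal (ren r M) (ren r e) (ren r A)"
  "ren r (restriction M e A P) = restriction (ren r M) (ren r e) (ren r A) (ren r P)"
  "ren r (ind_type i M e) = ind_type i (ren r M) (ren r e)"
  "ren r (comp_type i M e d) = comp_type i (ren r M) (ren r e) (ren r d)"
  "ren r (modal_id_type i M e) = modal_id_type i (ren r M) (ren r e)"
  "ren r (higher_modality_structure i M e) = higher_modality_structure i (ren r M) (ren r e)"
  "ren r (unique_elim_structure i M e) = unique_elim_structure i (ren r M) (ren r e)"
  by (simp_all add: operator_type_def unit_type_def modal_family_def modal_sections_def is_modal_def
    restriction_def ind_type_def comp_type_def modal_id_type_def higher_modality_structure_def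
    unique_elim_structure_def calc_equiv)

lemma modal_subst:
  "subst s (operator_type i) = operator_type i"
  "subst s (unit_type i M) = unit_type i (subst s M)"
  "subst s (modal_family M A P) = modal_family (subst s M) (subst s A) (subst s P)"
  "subst s (modal_sections M A P f) = modal_sections (subst s M) (subst s A) (subst s P) (subst s f)"
  "subst s (is_modal M e A) = is_modal (subst s M) (subst s e) (subst s A)"
  "subst s (restriction M e A P) = restriction (subst s M) (subst s e) (subst s A) (subst s P)"
  "subst s (ind_type i M e) = ind_type i (subst s M) (subst s e)"
  "subst s (comp_type i M e d) = comp_type i (subst s M) (subst s e) (subst s d)"
  "subst s (modal_id_type i M e) = modal_id_type i (subst s M) (subst s e)"
  "subst s (higher_modality_structure i M e) = higher_modality_structure i (subst s M) (subst s e)"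
  "subst s (unique_elim_structure i M e) = unique_elim_structure i (subst s M) (subst s e)"
  by (simp_all add: operator_type_def unit_type_def modal_family_def modal_sections_def is_modal_def
    restriction_def ind_type_def comp_type_def modal_id_type_def higher_modality_structure_def
    unique_elim_structure_def calc_equiv)

lemmas modal_calc = calc_equiv modal_ren modal_subst

lemma operator_form: "wf_ctx G \<Longrightarrow> G \<turnstile> operator_type i \<Colon> U (Suc i)"
  unfolding operator_type_def by (intro arr_form U_intro)

lemma operator_elim: "G \<turnstile> M \<Colon> operator_type i \<Longrightarrow> G \<turnstile> A \<Colon> U i \<Longrightarrow> G \<turnstile> M \<cdot> A \<Colon> U i"
  unfolding operator_type_def by (rule arr_elim)

lemma weaken_operator: "G \<turnstile> M \<Colon> operator_type i \<Longrightarrow> wf_ctx (C # G) \<Longrightarrow> C # G \<turnstile> ren Suc M \<Colon> operator_type i"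
  using weaken[of C G M "operator_type i"] by (simp add: modal_calc)

lemma weaken_data: "modal_data i G M e \<Longrightarrow> wf_ctx (C # G) \<Longrightarrow> modal_data i (C # G) (ren Suc M) (ren Suc e)"
  using weaken[of C G M "operator_type i"] weaken[of C G e "unit_type i M"]
  by (simp add: modal_data_def modal_calc)

lemma Var0_U: "wf_ctx (U i # G) \<Longrightarrow> U i # G \<turnstile> Var 0 \<Colon> U i"
  using Var0[of "U i" G] by simp

lemma unit_form:
  assumes "G \<turnstile> M \<Colon> operator_type i"
  shows "G \<turnstile> unit_type i M \<Colon> U (Suc i)"
proof -
  have wf: "wf_ctx (U i # G)"
    by (rule ctx_ext[OF U_intro[OF typing_wf[OF assms]]])
  have "U i # G \<turnstile> Var 0 \<rightharpoondown> ren Suc M \<cdot> Var 0 \<Colon> U (Suc i)"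
    by (intro U_cumul arr_form operator_elim weaken_operator Var0_U wf assms)
  then show ?thesis
    unfolding unit_type_def shift_def using typing_wf[OF assms] by (auto intro: Pi_form U_intro)
qed

context
  fixes i G M e
  assumes data: "modal_data i G M e"
begin

lemma data_operator: "G \<turnstile> M \<Colon> operator_type i" and data_unit: "G \<turnstile> e \<Colon> unit_type i M"
  using data by (auto simp: modal_data_def)

lemma data_wf: "wf_ctx G"
  by (rule typing_wf[OF data_operator])

lemma op_form: "G \<turnstile> A \<Colon> U i \<Longrightarrow> G \<turnstile> M \<cdot> A \<Colon> U i"
  by (rule operator_elim[OF data_operator])

lemma unit_arr: "G \<turnstile> A \<Colon> U i \<Longrightarrow> G \<turnstile> e \<cdot> A \<Colon> A \<rightharpoondown> M \<cdot> A"
  using Pi_elim[OF data_unit[unfolded unit_type_def]] by (simp add: calc_equiv)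

lemma unit_elim: "G \<turnstile> A \<Colon> U i \<Longrightarrow> G \<turnstile> a \<Colon> A \<Longrightarrow> G \<turnstile> e \<cdot> A \<cdot> a \<Colon> M \<cdot> A"
  by (rule arr_elim[OF unit_arr])

lemma is_modal_form: "G \<turnstile> A \<Colon> U i \<Longrightarrow> G \<turnstile> is_modal M e A \<Colon> U i"
  unfolding is_modal_def by (intro is_equiv_form op_form unit_arr)

end

lemma family_body_form:
  assumes "modal_data i G M e" "G \<turnstile> A \<Colon> U i" "G \<turnstile> P \<Colon> M \<cdot> A \<rightharpoondown> U i"
  shows "M \<cdot> A # G \<turnstile> ren Suc M \<cdot> (ren Suc P \<cdot> Var 0) \<Colon> U i"
proof -
  note wf = ctx_ext[OF op_form[OF assms(1,2)]]
  show ?thesis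
    by (rule op_form[OF weaken_data[OF assms(1) wf] family_body[OF op_form[OF assms(1,2)] assms(3)]])
qed

lemma modal_family_form:
  assumes "modal_data i G M e" "G \<turnstile> A \<Colon> U i" "G \<turnstile> P \<Colon> M \<cdot> A \<rightharpoondown> U i"
  shows "G \<turnstile> modal_family M A P \<Colon> U i"
  using Pi_form[OF op_form[OF assms(1,2)] family_body_form[OF assms]]
  by (simp add: modal_family_def shift_def)

lemma sections_body_form:
  assumes "modal_data i G M e" "G \<turnstile> A \<Colon> U i" "G \<turnstile> P \<Colon> M \<cdot> A \<rightharpoondown> U i"
  shows "A # G \<turnstile> ren Suc M \<cdot> (ren Suc P \<cdot> (ren Suc e \<cdot> ren Suc A \<cdot> Var 0)) \<Colon> U i"
proof -
  note wf = ctx_ext[OF assms(2)]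
  note d = weaken_data[OF assms(1) wf]
  have "A # G \<turnstile> ren Suc P \<Colon> ren Suc M \<cdot> ren Suc A \<rightharpoondown> U i"
    using weaken_family[OF assms(3) wf] by simp
  from arr_elim[OF this unit_elim[OF d weaken_U[OF assms(2) wf] Var0[OF wf]]]
  show ?thesis
    by (rule op_form[OF d])
qed

lemma sections_alt:
  "modal_sections M A P (e \<cdot> A) = Pi A (ren Suc M \<cdot> (ren Suc P \<cdot> (ren Suc e \<cdot> ren Suc A \<cdot> Var 0)))"
  by (simp add: modal_sections_def shift_def)

lemma modal_sections_form:
  assumes "modal_data i G M e" "G \<turnstile> A \<Colon> U i" "G \<turnstile> P \<Colon> M \<cdot> A \<rightharpoondown> U i"
  shows "G \<turnstile> modal_sections M A P (e \<cdot> A) \<Colon> U i"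
  unfolding sections_alt by (intro Pi_form sections_body_form assms)

lemma modal_family_elim:
  "G \<turnstile> s \<Colon> modal_family M A P \<Longrightarrow> G \<turnstile> z \<Colon> M \<cdot> A \<Longrightarrow> G \<turnstile> s \<cdot> z \<Colon> M \<cdot> (P \<cdot> z)"
  unfolding modal_family_def by (drule (1) Pi_elim) (simp add: calc)

lemma modal_sections_elim:
  "G \<turnstile> f \<Colon> modal_sections M A P h \<Longrightarrow> G \<turnstile> a \<Colon> A \<Longrightarrow> G \<turnstile> f \<cdot> a \<Colon> M \<cdot> (P \<cdot> (h \<cdot> a))"
  unfolding modal_sections_def by (drule (1) Pi_elim) (simp add: calc)

lemma weaken_modal_family:
  "G \<turnstile> s \<Colon> modal_family M A P \<Longrightarrow> wf_ctx (C # G)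
    \<Longrightarrow> C # G \<turnstile> ren Suc s \<Colon> modal_family (ren Suc M) (ren Suc A) (ren Suc P)"
  using weaken[of C G s "modal_family M A P"] by (simp add: modal_calc)

lemma weaken_modal_sections:
  "G \<turnstile> s \<Colon> modal_sections M A P h \<Longrightarrow> wf_ctx (C # G)
    \<Longrightarrow> C # G \<turnstile> ren Suc s \<Colon> modal_sections (ren Suc M) (ren Suc A) (ren Suc P) (ren Suc h)"
  using weaken[of C G s "modal_sections M A P h"] by (simp add: modal_calc)

lemma weaken_P:
  "G \<turnstile> P \<Colon> M \<cdot> A \<rightharpoondown> U i \<Longrightarrow> wf_ctx (C # G) \<Longrightarrow> C # G \<turnstile> ren Suc P \<Colon> ren Suc M \<cdot> ren Suc A \<rightharpoondown> U i"
  using weaken_family[of G P "M \<cdot> A" i C] by simp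

section \<open>Restriction along the unit\<close>

lemma restriction_body:
  assumes "modal_data i G M e" "G \<turnstile> A \<Colon> U i" "G \<turnstile> P \<Colon> M \<cdot> A \<rightharpoondown> U i" "G \<turnstile> s \<Colon> modal_family M A P"
  shows "A # G \<turnstile> ren Suc s \<cdot> (ren Suc e \<cdot> ren Suc A \<cdot> Var 0)
    \<Colon> ren Suc M \<cdot> (ren Suc P \<cdot> (ren Suc e \<cdot> ren Suc A \<cdot> Var 0))"
proof -
  note wf = ctx_ext[OF assms(2)]
  show ?thesis
    by (rule modal_family_elim[OF weaken_modal_family[OF assms(4) wf]])
      (rule unit_elim[OF weaken_data[OF assms(1) wf] weaken_U[OF assms(2) wf] Var0[OF wf]])
qed

lemma restriction_inner:
  assumes "modal_data i G M e" "G \<turnstile> A \<Colon> U i" "G \<turnstile> P \<Colon> M \<cdot> A \<rightharpoondown> U i"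
  shows "modal_family M A P # G \<turnstile> Lam (ren Suc A) (Var 1 \<cdot> (shift 2 e \<cdot> shift 2 A \<cdot> Var 0))
    \<Colon> ren Suc (modal_sections M A P (e \<cdot> A))"
proof -
  note wf = ctx_ext[OF modal_family_form[OF assms]]
  have "modal_family M A P # G \<turnstile> Var 0 \<Colon> modal_family (ren Suc M) (ren Suc A) (ren Suc P)"
    using Var0[OF wf] by (simp add: modal_calc)
  from Pi_intro[OF restriction_body[OF weaken_data[OF assms(1) wf] weaken_U[OF assms(2) wf]
    weaken_P[OF assms(3) wf] this]]
  show ?thesis by (simp add: sections_alt calc)
qed

lemma restriction_typing:
  assumes "modal_data i G M e" "G \<turnstile> A \<Colon> U i" "G \<turnstile> P \<Colon> M \<cdot> A \<rightharpoondown> U i"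
  shows "G \<turnstile> restriction M e A P \<Colon> modal_family M A P \<rightharpoondown> modal_sections M A P (e \<cdot> A)"
  unfolding restriction_def by (rule arr_intro[OF restriction_inner[OF assms]])

lemma restriction_beta:
  assumes "modal_data i G M e" "G \<turnstile> A \<Colon> U i" "G \<turnstile> P \<Colon> M \<cdot> A \<rightharpoondown> U i" "G \<turnstile> s \<Colon> modal_family M A P"
    and a: "G \<turnstile> a \<Colon> A"
  shows "G \<turnstile> restriction M e A P \<cdot> s \<cdot> a \<doteq> s \<cdot> (e \<cdot> A \<cdot> a) \<Colon> M \<cdot> (P \<cdot> (e \<cdot> A \<cdot> a))"
proof -
  have "G \<turnstile> restriction M e A P \<cdot> s \<doteq> Lam A (ren Suc s \<cdot> (ren Suc e \<cdot> ren Suc A \<cdot> Var 0))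
      \<Colon> modal_sections M A P (e \<cdot> A)"
    using Pi_comp[OF restriction_inner[OF assms(1-3)] assms(4)] by (simp add: restriction_def calc)
  from Pi_elim_eq[OF this[unfolded sections_alt] eq_refl[OF a]]
  have "G \<turnstile> restriction M e A P \<cdot> s \<cdot> a \<doteq> Lam A (ren Suc s \<cdot> (ren Suc e \<cdot> ren Suc A \<cdot> Var 0)) \<cdot> a
      \<Colon> M \<cdot> (P \<cdot> (e \<cdot> A \<cdot> a))"
    by (simp add: calc)
  moreover have "G \<turnstile> Lam A (ren Suc s \<cdot> (ren Suc e \<cdot> ren Suc A \<cdot> Var 0)) \<cdot> a \<doteq> s \<cdot> (e \<cdot> A \<cdot> a)
      \<Colon> M \<cdot> (P \<cdot> (e \<cdot> A \<cdot> a))"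
    using Pi_comp[OF restriction_body[OF assms(1-4)] a] by (simp add: calc)
  ultimately show ?thesis by (rule eq_trans)
qed

section \<open>Induction inverts restriction\<close>

lemma ind_elim:
  assumes "G \<turnstile> ind \<Colon> ind_type i M e" "G \<turnstile> A \<Colon> U i" "G \<turnstile> P \<Colon> M \<cdot> A \<rightharpoondown> U i"
  shows "G \<turnstile> ind \<cdot> A \<cdot> P \<Colon> modal_sections M A P (e \<cdot> A) \<rightharpoondown> modal_family M A P"
proof -
  from Pi_elim[OF assms(1)[unfolded ind_type_def] assms(2)]
  have "G \<turnstile> ind \<cdot> A \<Colon> Pi (M \<cdot> A \<rightharpoondown> U i)
      (modal_sections (ren Suc M) (ren Suc A) (Var 0) (ren Suc (e \<cdot> A))
        \<rightharpoondown> modal_family (ren Suc M) (ren Suc A) (Var 0))"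
    by (simp add: modal_calc)
  from Pi_elim[OF this assms(3)] show ?thesis
    by (simp add: modal_calc)
qed

lemma comp_elim:
  assumes "G \<turnstile> cmp \<Colon> comp_type i M e ind" "G \<turnstile> A \<Colon> U i" "G \<turnstile> P \<Colon> M \<cdot> A \<rightharpoondown> U i"
    "G \<turnstile> f \<Colon> modal_sections M A P (e \<cdot> A)" "G \<turnstile> a \<Colon> A"
  shows "G \<turnstile> cmp \<cdot> A \<cdot> P \<cdot> f \<cdot> a
    \<Colon> Id (M \<cdot> (P \<cdot> (e \<cdot> A \<cdot> a))) (ind \<cdot> A \<cdot> P \<cdot> f \<cdot> (e \<cdot> A \<cdot> a)) (f \<cdot> a)"
proof -
  from Pi_elim[OF assms(1)[unfolded comp_type_def] assms(2)]
  have "G \<turnstile> cmp \<cdot> A \<Colon> Pi (M \<cdot> A \<rightharpoondown> U i)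
      (Pi (modal_sections (shift 1 M) (shift 1 A) (Var 0) (shift 1 e \<cdot> shift 1 A))
        (Pi (shift 2 A)
          (Id (shift 3 M \<cdot> (Var 2 \<cdot> (shift 3 e \<cdot> shift 3 A \<cdot> Var 0)))
            (shift 3 ind \<cdot> shift 3 A \<cdot> Var 2 \<cdot> Var 1 \<cdot> (shift 3 e \<cdot> shift 3 A \<cdot> Var 0))
            (Var 1 \<cdot> Var 0))))"
    by (simp add: modal_calc)
  from Pi_elim[OF this assms(3)]
  have "G \<turnstile> cmp \<cdot> A \<cdot> P \<Colon> Pi (modal_sections M A P (e \<cdot> A))
        (Pi (shift 1 A)
          (Id (shift 2 M \<cdot> (shift 2 P \<cdot> (shift 2 e \<cdot> shift 2 A \<cdot> Var 0)))
            (shift 2 ind \<cdot> shift 2 A \<cdot> shift 2 P \<cdot> Var 1 \<cdot> (shift 2 e \<cdot> shift 2 A \<cdot> Var 0))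
            (Var 1 \<cdot> Var 0)))"
    by (simp add: modal_calc)
  from Pi_elim[OF this assms(4)]
  have "G \<turnstile> cmp \<cdot> A \<cdot> P \<cdot> f \<Colon> Pi A
          (Id (shift 1 M \<cdot> (shift 1 P \<cdot> (shift 1 e \<cdot> shift 1 A \<cdot> Var 0)))
            (shift 1 ind \<cdot> shift 1 A \<cdot> shift 1 P \<cdot> shift 1 f \<cdot> (shift 1 e \<cdot> shift 1 A \<cdot> Var 0))
            (shift 1 f \<cdot> Var 0))"
    by (simp add: modal_calc)
  from Pi_elim[OF this assms(5)] show ?thesis
    by (simp add: modal_calc)
qed

lemma modal_id_elim:
  assumes "G \<turnstile> mid \<Colon> modal_id_type i M e" "G \<turnstile> A \<Colon> U i" "G \<turnstile> x \<Colon> M \<cdot> A" "G \<turnstile> y \<Colon> M \<cdot> A"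
  shows "G \<turnstile> mid \<cdot> A \<cdot> x \<cdot> y \<Colon> is_modal M e (Id (M \<cdot> A) x y)"
proof -
  from Pi_elim[OF assms(1)[unfolded modal_id_type_def] assms(2)]
  have "G \<turnstile> mid \<cdot> A \<Colon> Pi (M \<cdot> A) (Pi (shift 1 M \<cdot> shift 1 A)
      (is_modal (shift 2 M) (shift 2 e) (Id (shift 2 M \<cdot> shift 2 A) (Var 1) (Var 0))))"
    by (simp add: modal_calc)
  from Pi_elim[OF this assms(3)]
  have "G \<turnstile> mid \<cdot> A \<cdot> x \<Colon> Pi (M \<cdot> A)
      (is_modal (shift 1 M) (shift 1 e) (Id (shift 1 M \<cdot> shift 1 A) (shift 1 x) (Var 0)))"
    by (simp add: modal_calc)
  from Pi_elim[OF this assms(4)] show ?thesis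
    by (simp add: modal_calc)
qed

definition higher_data :: "nat \<Rightarrow> ctx \<Rightarrow> tm \<Rightarrow> tm \<Rightarrow> tm \<Rightarrow> tm \<Rightarrow> tm \<Rightarrow> bool" where
  "higher_data i G M e ind cmp mid \<longleftrightarrow> modal_data i G M e \<and> G \<turnstile> ind \<Colon> ind_type i M e \<and>
    G \<turnstile> cmp \<Colon> comp_type i M e ind \<and> G \<turnstile> mid \<Colon> modal_id_type i M e"

lemma weaken_higher:
  "higher_data i G M e ind cmp mid \<Longrightarrow> wf_ctx (C # G) \<Longrightarrow>
    higher_data i (C # G) (ren Suc M) (ren Suc e) (ren Suc ind) (ren Suc cmp) (ren Suc mid)"
  using weaken_data[of i G M e C] weaken[of C G ind "ind_type i M e"]
    weaken[of C G cmp "comp_type i M e ind"] weaken[of C G mid "modal_id_type i M e"]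
  by (simp add: higher_data_def modal_calc)

text \<open>
  Pointwise, the left side is \<open>ind A P f (e A a)\<close> by \<open>\<beta>\<close>, which the computation rule identifies with \<open>f a\<close>.
\<close>
lemma restriction_ind:
  assumes h: "higher_data i G M e ind cmp mid" and A: "G \<turnstile> A \<Colon> U i" and P: "G \<turnstile> P \<Colon> M \<cdot> A \<rightharpoondown> U i"
    and f: "G \<turnstile> f \<Colon> modal_sections M A P (e \<cdot> A)"
  shows "\<exists>t. G \<turnstile> t \<Colon> Id (modal_sections M A P (e \<cdot> A)) (restriction M e A P \<cdot> (ind \<cdot> A \<cdot> P \<cdot> f)) f"
proof -
  let ?R = "ren Suc"
  note wf = ctx_ext[OF A]
  have d: "modal_data i G M e" and ind: "G \<turnstile> ind \<Colon> ind_type i M e"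
    using h by (auto simp: higher_data_def)
  have d1: "modal_data i (A # G) (?R M) (?R e)"
    and ind1: "A # G \<turnstile> ?R ind \<Colon> ind_type i (?R M) (?R e)"
    and cmp1: "A # G \<turnstile> ?R cmp \<Colon> comp_type i (?R M) (?R e) (?R ind)"
    using weaken_higher[OF h wf] by (auto simp: higher_data_def)
  note A1 = weaken_U[OF A wf] and P1 = weaken_P[OF P wf] and a1 = Var0[OF wf]
  have f1: "A # G \<turnstile> ?R f \<Colon> modal_sections (?R M) (?R A) (?R P) (?R e \<cdot> ?R A)"
    using weaken_modal_sections[OF f wf] by simp
  let ?T = "?R M \<cdot> (?R P \<cdot> (?R e \<cdot> ?R A \<cdot> Var 0))"
  have T: "A # G \<turnstile> ?T \<Colon> U i"
    by (rule sections_body_form[OF d A P])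
  have g1: "A # G \<turnstile> ?R ind \<cdot> ?R A \<cdot> ?R P \<cdot> ?R f \<Colon> modal_family (?R M) (?R A) (?R P)"
    by (rule arr_elim[OF ind_elim[OF ind1 A1 P1] f1])
  have "A # G \<turnstile> restriction (?R M) (?R e) (?R A) (?R P) \<cdot> (?R ind \<cdot> ?R A \<cdot> ?R P \<cdot> ?R f) \<cdot> Var 0
      \<doteq> ?R ind \<cdot> ?R A \<cdot> ?R P \<cdot> ?R f \<cdot> (?R e \<cdot> ?R A \<cdot> Var 0) \<Colon> ?T"
    by (rule restriction_beta[OF d1 A1 P1 g1 a1])
  then have "A # G \<turnstile> Id ?T (?R ind \<cdot> ?R A \<cdot> ?R P \<cdot> ?R f \<cdot> (?R e \<cdot> ?R A \<cdot> Var 0)) (?R f \<cdot> Var 0)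
      \<doteq> Id ?T (?R (restriction M e A P \<cdot> (ind \<cdot> A \<cdot> P \<cdot> f)) \<cdot> Var 0) (?R f \<cdot> Var 0) \<Colon> U i"
    by (intro Id_form_eq eq_refl T modal_sections_elim[OF f1 a1]) (simp add: modal_ren eq_sym)
  from conv[OF comp_elim[OF cmp1 A1 P1 f1 a1] this]
  have k: "A # G \<turnstile> ?R cmp \<cdot> ?R A \<cdot> ?R P \<cdot> ?R f \<cdot> Var 0 \<Colon>
    Id ?T (?R (restriction M e A P \<cdot> (ind \<cdot> A \<cdot> P \<cdot> f)) \<cdot> Var 0) (?R f \<cdot> Var 0)" .
  have "G \<turnstile> restriction M e A P \<cdot> (ind \<cdot> A \<cdot> P \<cdot> f) \<Colon> modal_sections M A P (e \<cdot> A)"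
    by (rule arr_elim[OF restriction_typing[OF d A P] arr_elim[OF ind_elim[OF ind A P] f]])
  from funext[OF A T this[unfolded sections_alt] f[unfolded sections_alt] k]
  show ?thesis unfolding sections_alt .
qed

text \<open>
  The heart of the proof: an identity type of \<open>M (P z)\<close> is modal, so a family of such types over \<open>M A\<close>
  admits induction along \<open>e\<close> like a family in the image of \<open>M\<close>.
\<close>
lemma ind_restriction_pointwise:
  assumes h: "higher_data i G M e ind cmp mid" and A: "G \<turnstile> A \<Colon> U i" and P: "G \<turnstile> P \<Colon> M \<cdot> A \<rightharpoondown> U i"
    and s: "G \<turnstile> s \<Colon> modal_family M A P" and z: "G \<turnstile> z \<Colon> M \<cdot> A"
  shows "\<exists>t. G \<turnstile> t \<Colon> Id (M \<cdot> (P \<cdot> z)) (ind \<cdot> A \<cdot> P \<cdot> (restriction M e A P \<cdot> s) \<cdot> z) (s \<cdot> z)"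
proof -
  let ?R = "ren Suc"
  have d: "modal_data i G M e" and ind: "G \<turnstile> ind \<Colon> ind_type i M e"
    and cmp: "G \<turnstile> cmp \<Colon> comp_type i M e ind" and mid: "G \<turnstile> mid \<Colon> modal_id_type i M e"
    using h by (auto simp: higher_data_def)
  \<comment> \<open>\<open>?Q\<close> is the family \<open>z \<mapsto> (ind A P (F s) z = s z)\<close>, \<open>?b\<close> its body and \<open>?I z\<close> its reduct at \<open>z\<close>.\<close>
  let ?s' = "ind \<cdot> A \<cdot> P \<cdot> (restriction M e A P \<cdot> s)"
  let ?I = "\<lambda>z. Id (M \<cdot> (P \<cdot> z)) (?s' \<cdot> z) (s \<cdot> z)"
  let ?b = "Id (?R M \<cdot> (?R P \<cdot> Var 0)) (?R ?s' \<cdot> Var 0) (?R s \<cdot> Var 0)"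
  let ?Q = "Lam (M \<cdot> A) ?b"
  note MA = op_form[OF d A]
  have rs: "G \<turnstile> restriction M e A P \<cdot> s \<Colon> modal_sections M A P (e \<cdot> A)"
    by (rule arr_elim[OF restriction_typing[OF d A P] s])
  have s': "G \<turnstile> ?s' \<Colon> modal_family M A P"
    by (rule arr_elim[OF ind_elim[OF ind A P] rs])
  have b: "M \<cdot> A # G \<turnstile> ?b \<Colon> U i"
  proof -
    note wf = ctx_ext[OF MA]
    have v: "M \<cdot> A # G \<turnstile> Var 0 \<Colon> ?R M \<cdot> ?R A"
      using Var0[OF wf] by simp
    show ?thesis
      by (intro Id_form family_body_form[OF d A P]
        modal_family_elim[OF weaken_modal_family[OF s' wf] v]
        modal_family_elim[OF weaken_modal_family[OF s wf] v])
  qed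
  have Q: "G \<turnstile> ?Q \<Colon> M \<cdot> A \<rightharpoondown> U i"
    by (rule arr_intro) (simp add: b[simplified])
  have beta: "G \<turnstile> ?Q \<cdot> z \<doteq> ?I z \<Colon> U i"
    using Pi_comp[OF b z] by (simp add: calc)
  note wf = ctx_ext[OF A]
  have d1: "modal_data i (A # G) (?R M) (?R e)"
    and cmp1: "A # G \<turnstile> ?R cmp \<Colon> comp_type i (?R M) (?R e) (?R ind)"
    using weaken_higher[OF h wf] by (auto simp: higher_data_def)
  note A1 = weaken_U[OF A wf] and P1 = weaken_P[OF P wf] and a1 = Var0[OF wf]
    and s1 = weaken_modal_family[OF s wf] and s1' = weaken_modal_family[OF s' wf]
  have rs1: "A # G \<turnstile> ?R (restriction M e A P \<cdot> s) \<Colon> modal_sections (?R M) (?R A) (?R P) (?R e \<cdot> ?R A)"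
    using weaken_modal_sections[OF rs wf] by simp
  let ?ea = "?R e \<cdot> ?R A \<cdot> Var 0"
  have ea: "A # G \<turnstile> ?ea \<Colon> ?R M \<cdot> ?R A"
    by (rule unit_elim[OF d1 A1 a1])
  let ?T = "?R M \<cdot> (?R P \<cdot> ?ea)"
  have T: "A # G \<turnstile> ?T \<Colon> U i"
    by (rule sections_body_form[OF d A P])
  have beta1: "A # G \<turnstile> ?R ?Q \<cdot> ?ea \<doteq> Id ?T (?R ?s' \<cdot> ?ea) (?R s \<cdot> ?ea) \<Colon> U i"
  proof -
    have "?R (M \<cdot> A) # A # G \<turnstile> ren (up_ren Suc) ?b \<Colon> U i"
      using stableD1(1)[OF renaming_stable(2)[OF b] renaming_Suc[OF wf]] by simp
    from Pi_comp[OF this] ea show ?thesis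
      by (simp add: calc)
  qed
  have "A # G \<turnstile> restriction (?R M) (?R e) (?R A) (?R P) \<cdot> ?R s \<cdot> Var 0 \<doteq> ?R s \<cdot> ?ea \<Colon> ?T"
    by (rule restriction_beta[OF d1 A1 P1 s1 a1])
  then have "A # G \<turnstile> Id ?T (?R ?s' \<cdot> ?ea) (?R (restriction M e A P \<cdot> s) \<cdot> Var 0)
      \<doteq> Id ?T (?R ?s' \<cdot> ?ea) (?R s \<cdot> ?ea) \<Colon> U i"
    by (intro Id_form_eq eq_refl T modal_family_elim[OF s1' ea]) (simp add: modal_ren)
  from eq_trans[OF this eq_sym[OF beta1]]
  have "A # G \<turnstile> Id ?T (?R ?s' \<cdot> ?ea) (?R (restriction M e A P \<cdot> s) \<cdot> Var 0) \<doteq> ?R ?Q \<cdot> ?ea \<Colon> U i" .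
  from conv[OF _ this] comp_elim[OF cmp1 A1 P1 rs1 a1]
  have k: "A # G \<turnstile> ?R cmp \<cdot> ?R A \<cdot> ?R P \<cdot> ?R (restriction M e A P \<cdot> s) \<cdot> Var 0 \<Colon> ?R ?Q \<cdot> ?ea"
    (is "_ \<turnstile> ?k \<Colon> _")
    by simp
  have "A # G \<turnstile> ?R ?Q \<cdot> ?ea \<Colon> U i"
    by (rule arr_elim[OF weaken_P[OF Q wf] ea])
  from unit_elim[OF d1 this k]
  have "G \<turnstile> Lam A (?R e \<cdot> (?R ?Q \<cdot> ?ea) \<cdot> ?k) \<Colon> modal_sections M A ?Q (e \<cdot> A)"
    unfolding sections_alt by (rule Pi_intro)
  \<comment> \<open>Induction for \<open>?Q\<close>; its hypothesis is the unit applied to the computation rule.\<close>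
  from modal_family_elim[OF arr_elim[OF ind_elim[OF ind A Q] this] z]
  obtain q where q: "G \<turnstile> q \<Colon> M \<cdot> (?Q \<cdot> z)"
    by blast
  have "G \<turnstile> M \<cdot> (?Q \<cdot> z) \<doteq> M \<cdot> ?I z \<Colon> U i"
    by (rule arr_elim_eq[OF eq_refl beta]) (rule data_operator[OF d, unfolded operator_type_def])
  from conv[OF q this] have q': "G \<turnstile> q \<Colon> M \<cdot> ?I z" .
  have Pz: "G \<turnstile> P \<cdot> z \<Colon> U i"
    by (rule arr_elim[OF P z])
  have I: "G \<turnstile> ?I z \<Colon> U i"
    by (intro Id_form op_form[OF d Pz] modal_family_elim[OF s' z] modal_family_elim[OF s z])
  \<comment> \<open>\<open>?I z\<close> is modal, so \<open>M\<close> can be removed.\<close>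
  from modal_id_elim[OF mid Pz modal_family_elim[OF s' z] modal_family_elim[OF s z]]
  obtain v where "G \<turnstile> v \<Colon> M \<cdot> ?I z \<rightharpoondown> ?I z"
    unfolding is_modal_def using is_equiv_inverse[OF I op_form[OF d I] unit_arr[OF d I]] by blast
  from arr_elim[OF this q'] show ?thesis by blast
qed

lemma ind_restriction:
  assumes h: "higher_data i G M e ind cmp mid" and A: "G \<turnstile> A \<Colon> U i" and P: "G \<turnstile> P \<Colon> M \<cdot> A \<rightharpoondown> U i"
    and s: "G \<turnstile> s \<Colon> modal_family M A P"
  shows "\<exists>t. G \<turnstile> t \<Colon> Id (modal_family M A P) (ind \<cdot> A \<cdot> P \<cdot> (restriction M e A P \<cdot> s)) s"
proof -
  have d: "modal_data i G M e" and ind: "G \<turnstile> ind \<Colon> ind_type i M e"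
    using h by (auto simp: higher_data_def)
  note MA = op_form[OF d A]
  note wf = ctx_ext[OF MA]
  have v: "M \<cdot> A # G \<turnstile> Var 0 \<Colon> ren Suc M \<cdot> ren Suc A"
    using Var0[OF wf] by simp
  have alt: "modal_family M A P = Pi (M \<cdot> A) (ren Suc M \<cdot> (ren Suc P \<cdot> Var 0))"
    by (simp add: modal_family_def shift_def)
  obtain k where "M \<cdot> A # G \<turnstile> k \<Colon> Id (ren Suc M \<cdot> (ren Suc P \<cdot> Var 0))
      (ren Suc (ind \<cdot> A \<cdot> P \<cdot> (restriction M e A P \<cdot> s)) \<cdot> Var 0) (ren Suc s \<cdot> Var 0)"
    using ind_restriction_pointwise[OF weaken_higher[OF h wf] weaken_U[OF A wf] weaken_P[OF P wf]
      weaken_modal_family[OF s wf] v] by (auto simp: modal_ren)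
  moreover have "G \<turnstile> ind \<cdot> A \<cdot> P \<cdot> (restriction M e A P \<cdot> s) \<Colon> modal_family M A P"
    by (rule arr_elim[OF ind_elim[OF ind A P] arr_elim[OF restriction_typing[OF d A P] s]])
  ultimately show ?thesis
    using funext[OF MA family_body_form[OF d A P]] s unfolding alt by blast
qed

lemma restriction_is_equiv:
  assumes h: "higher_data i G M e ind cmp mid" and A: "G \<turnstile> A \<Colon> U i" and P: "G \<turnstile> P \<Colon> M \<cdot> A \<rightharpoondown> U i"
  shows "\<exists>t. G \<turnstile> t \<Colon> is_equiv (modal_family M A P) (modal_sections M A P (e \<cdot> A)) (restriction M e A P)"
proof -
  let ?X = "modal_family M A P" and ?Y = "modal_sections M A P (e \<cdot> A)"
  have d: "modal_data i G M e" and ind: "G \<turnstile> ind \<Colon> ind_type i M e"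
    using h by (auto simp: higher_data_def)
  note X = modal_family_form[OF d A P] and Y = modal_sections_form[OF d A P]
    and g = ind_elim[OF ind A P]
  note wfX = ctx_ext[OF X] and wfY = ctx_ext[OF Y]
  have vX: "?X # G \<turnstile> Var 0 \<Colon> modal_family (ren Suc M) (ren Suc A) (ren Suc P)"
    using Var0[OF wfX] by (simp add: modal_ren)
  have vY: "?Y # G \<turnstile> Var 0 \<Colon> modal_sections (ren Suc M) (ren Suc A) (ren Suc P) (ren Suc e \<cdot> ren Suc A)"
    using Var0[OF wfY] by (simp add: modal_ren)
  obtain p where "?Y # G \<turnstile> p \<Colon> Id (ren Suc ?Y)
      (ren Suc (restriction M e A P) \<cdot> (ren Suc (ind \<cdot> A \<cdot> P) \<cdot> Var 0)) (Var 0)"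
    using restriction_ind[OF weaken_higher[OF h wfY] weaken_U[OF A wfY] weaken_P[OF P wfY] vY]
    by (auto simp: modal_ren)
  from Pi_intro[OF this] have p: "G \<turnstile> Lam ?Y p \<Colon> inverse_law ?Y (restriction M e A P) (ind \<cdot> A \<cdot> P)"
    unfolding inverse_law_def .
  obtain q where "?X # G \<turnstile> q \<Colon> Id (ren Suc ?X)
      (ren Suc (ind \<cdot> A \<cdot> P) \<cdot> (ren Suc (restriction M e A P) \<cdot> Var 0)) (Var 0)"
    using ind_restriction[OF weaken_higher[OF h wfX] weaken_U[OF A wfX] weaken_P[OF P wfX] vX]
    by (auto simp: modal_ren)
  from Pi_intro[OF this] have q: "G \<turnstile> Lam ?X q \<Colon> inverse_law ?X (ind \<cdot> A \<cdot> P) (restriction M e A P)"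
    unfolding inverse_law_def .
  show ?thesis
    using is_equiv_intro[OF X Y restriction_typing[OF d A P] g p g q] by blast
qed

section \<open>Formation of the structure types\<close>

text \<open>
  The context below the two quantifiers shared by the induction principle, its computation rule and
  unique elimination.  A statement about arbitrary \<open>A\<close> and \<open>P\<close> is carried below them by instantiating
  it at these variables.
\<close>
lemma family_ctx:
  assumes "modal_data i G M e"
  defines "D \<equiv> (ren Suc M \<cdot> Var 0 \<rightharpoondown> U i) # U i # G"
  shows "U i # G \<turnstile> ren Suc M \<cdot> Var 0 \<rightharpoondown> U i \<Colon> U (Suc i)"
    and "wf_ctx (U i # G)" and "wf_ctx D"
    and "modal_data i D (shift 2 M) (shift 2 e)"
    and "D \<turnstile> Var 1 \<Colon> U i" and "D \<turnstile> Var 0 \<Colon> shift 2 M \<cdot> Var 1 \<rightharpoondown> U i"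
proof -
  show wf1: "wf_ctx (U i # G)"
    by (rule ctx_ext[OF U_intro[OF data_wf[OF assms(1)]]])
  note d1 = weaken_data[OF assms(1) wf1]
  show "U i # G \<turnstile> ren Suc M \<cdot> Var 0 \<rightharpoondown> U i \<Colon> U (Suc i)"
    by (intro arr_form U_cumul[OF op_form[OF d1]] U_intro wf1 Var0_U)
  from ctx_ext[OF this] show wf2: "wf_ctx D" unfolding D_def .
  show "modal_data i D (shift 2 M) (shift 2 e)"
    using weaken_data[OF d1 wf2[unfolded D_def]] by (simp add: D_def calc)
  show "D \<turnstile> Var 1 \<Colon> U i"
    using VarS[OF wf2[unfolded D_def] Var0_U[OF wf1]] by (simp add: D_def)
  show "D \<turnstile> Var 0 \<Colon> shift 2 M \<cdot> Var 1 \<rightharpoondown> U i"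
    using Var0[OF wf2[unfolded D_def]] by (simp add: D_def calc_equiv)
qed

lemma Pi_family_form:
  assumes "modal_data i G M e" "(ren Suc M \<cdot> Var 0 \<rightharpoondown> U i) # U i # G \<turnstile> B \<Colon> U (Suc i)"
  shows "G \<turnstile> Pi (U i) (Pi (shift 1 M \<cdot> Var 0 \<rightharpoondown> U i) B) \<Colon> U (Suc i)"
proof -
  have "U i # G \<turnstile> Pi (ren Suc M \<cdot> Var 0 \<rightharpoondown> U i) B \<Colon> U (Suc i)"
    by (rule Pi_form[OF family_ctx(1)[OF assms(1)] assms(2)])
  from Pi_form[OF U_intro[OF data_wf[OF assms(1)]] this] show ?thesis
    by (simp add: shift_def)
qed

lemma ind_form:
  assumes "modal_data i G M e"
  shows "G \<turnstile> ind_type i M e \<Colon> U (Suc i)"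
  unfolding ind_type_def
  using family_ctx(4-)[OF assms]
  by (intro Pi_family_form[OF assms] U_cumul arr_form modal_sections_form modal_family_form)

lemma comp_body_form:
  assumes d: "modal_data i G M e" and ind: "G \<turnstile> ind \<Colon> ind_type i M e"
    and A: "G \<turnstile> A \<Colon> U i" and P: "G \<turnstile> P \<Colon> M \<cdot> A \<rightharpoondown> U i" and f: "G \<turnstile> f \<Colon> modal_sections M A P (e \<cdot> A)"
  shows "G \<turnstile> Pi A (Id (ren Suc M \<cdot> (ren Suc P \<cdot> (ren Suc e \<cdot> ren Suc A \<cdot> Var 0)))
    (ren Suc ind \<cdot> ren Suc A \<cdot> ren Suc P \<cdot> ren Suc f \<cdot> (ren Suc e \<cdot> ren Suc A \<cdot> Var 0))
    (ren Suc f \<cdot> Var 0)) \<Colon> U i"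
proof -
  note wf = ctx_ext[OF A]
  note d1 = weaken_data[OF d wf] and A1 = weaken_U[OF A wf] and P1 = weaken_P[OF P wf]
    and a1 = Var0[OF wf]
  have f1: "A # G \<turnstile> ren Suc f \<Colon> modal_sections (ren Suc M) (ren Suc A) (ren Suc P) (ren Suc e \<cdot> ren Suc A)"
    using weaken_modal_sections[OF f wf] by simp
  have ind1: "A # G \<turnstile> ren Suc ind \<Colon> ind_type i (ren Suc M) (ren Suc e)"
    using weaken[OF wf ind] by (simp add: modal_ren)
  show ?thesis
    by (intro Pi_form A Id_form sections_body_form[OF d A P] modal_sections_elim[OF f1 a1]
      modal_family_elim[OF arr_elim[OF ind_elim[OF ind1 A1 P1] f1] unit_elim[OF d1 A1 a1]])
qed

lemma comp_form:
  assumes d: "modal_data i G M e" and ind: "G \<turnstile> ind \<Colon> ind_type i M e"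
  shows "G \<turnstile> comp_type i M e ind \<Colon> U (Suc i)"
proof -
  let ?D = "(ren Suc M \<cdot> Var 0 \<rightharpoondown> U i) # U i # G"
  note ctx = family_ctx[OF d]
  let ?Y = "modal_sections (shift 2 M) (Var 1) (Var 0) (shift 2 e \<cdot> Var 1)"
  have Y: "?D \<turnstile> ?Y \<Colon> U i"
    by (rule modal_sections_form[OF ctx(4-6)])
  note wf = ctx_ext[OF Y]
  have "?D \<turnstile> shift 2 ind \<Colon> ind_type i (shift 2 M) (shift 2 e)"
    using weaken[OF ctx(3) weaken[OF ctx(2) ind]] by (simp add: modal_calc)
  from weaken[OF wf this]
  have ind3: "?Y # ?D \<turnstile> shift 3 ind \<Colon> ind_type i (shift 3 M) (shift 3 e)"
    by (simp add: modal_calc)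
  have d3: "modal_data i (?Y # ?D) (shift 3 M) (shift 3 e)"
    using weaken_data[OF ctx(4) wf] by (simp add: calc)
  have A3: "?Y # ?D \<turnstile> Var 2 \<Colon> U i"
    using weaken_U[OF ctx(5) wf] by (simp add: calc)
  have P3: "?Y # ?D \<turnstile> Var 1 \<Colon> shift 3 M \<cdot> Var 2 \<rightharpoondown> U i"
    using weaken_P[OF ctx(6) wf] by (simp add: calc)
  have f3: "?Y # ?D \<turnstile> Var 0 \<Colon> modal_sections (shift 3 M) (Var 2) (Var 1) (shift 3 e \<cdot> Var 2)"
    using Var0[OF wf] by (simp add: modal_calc)
  have "?D \<turnstile> Pi ?Y (Pi (Var 2)
          (Id (shift 4 M \<cdot> (Var 2 \<cdot> (shift 4 e \<cdot> Var 3 \<cdot> Var 0)))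
            (shift 4 ind \<cdot> Var 3 \<cdot> Var 2 \<cdot> Var 1 \<cdot> (shift 4 e \<cdot> Var 3 \<cdot> Var 0))
            (Var 1 \<cdot> Var 0))) \<Colon> U i"
    using comp_body_form[OF d3 ind3 A3 P3 f3] by (intro Pi_form[OF Y]) (simp add: calc)
  from Pi_family_form[OF d U_cumul[OF this]] show ?thesis
    unfolding comp_type_def .
qed

lemma modal_id_form:
  assumes d: "modal_data i G M e"
  shows "G \<turnstile> modal_id_type i M e \<Colon> U (Suc i)"
proof -
  note wf1 = family_ctx(2)[OF d]
  note d1 = weaken_data[OF d wf1]
  note X1 = op_form[OF d1 Var0_U[OF wf1]]
  note wf2 = ctx_ext[OF X1]
  note d2 = weaken_data[OF d1 wf2]
  note X2 = weaken_U[OF X1 wf2]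
  note wf3 = ctx_ext[OF X2]
  note d3 = weaken_data[OF d2 wf3]
  note X3 = weaken_U[OF X2 wf3]
  note x3 = VarS[OF wf3 Var0[OF wf2]]
  note y3 = Var0[OF wf3]
  have "U i # G \<turnstile> Pi (ren Suc M \<cdot> Var 0) (Pi (shift 2 M \<cdot> Var 1)
      (is_modal (shift 3 M) (shift 3 e) (Id (shift 3 M \<cdot> Var 2) (Var 1) (Var 0)))) \<Colon> U i"
    using Pi_form[OF X1 Pi_form[OF X2 is_modal_form[OF d3 Id_form[OF X3 x3 y3]]]] by (simp add: calc)
  from Pi_form[OF U_intro[OF data_wf[OF d]] U_cumul[OF this]] show ?thesis
    by (simp add: modal_id_type_def shift_def)
qed

lemma ind_comp_parts:
  assumes d: "modal_data i G M e"
  shows "ind_type i M e # G \<turnstile> comp_type i (shift 1 M) (shift 1 e) (Var 0) \<Colon> U (Suc i)"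
    and "G \<turnstile> Sig (ind_type i M e) (comp_type i (shift 1 M) (shift 1 e) (Var 0)) \<Colon> U (Suc i)"
proof -
  note wf = ctx_ext[OF ind_form[OF d]]
  show *: "ind_type i M e # G \<turnstile> comp_type i (shift 1 M) (shift 1 e) (Var 0) \<Colon> U (Suc i)"
    using comp_form[OF weaken_data[OF d wf]] Var0[OF wf] by (simp add: modal_ren shift_def)
  show "G \<turnstile> Sig (ind_type i M e) (comp_type i (shift 1 M) (shift 1 e) (Var 0)) \<Colon> U (Suc i)"
    by (rule Sig_form[OF ind_form[OF d] *])
qed

lemma higher_structure_form:
  "modal_data i G M e \<Longrightarrow> G \<turnstile> higher_modality_structure i M e \<Colon> U (Suc i)"
  unfolding higher_modality_structure_def by (intro times_form ind_comp_parts modal_id_form)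

lemma unique_elim_alt:
  "unique_elim_structure i M e = Pi (U i) (Pi (shift 1 M \<cdot> Var 0 \<rightharpoondown> U i)
    (is_equiv (modal_family (shift 2 M) (Var 1) (Var 0))
      (modal_sections (shift 2 M) (Var 1) (Var 0) (shift 2 e \<cdot> Var 1))
      (restriction (shift 2 M) (shift 2 e) (Var 1) (Var 0))))"
  by (simp add: unique_elim_structure_def restriction_def calc)

lemma unique_elim_form:
  assumes "modal_data i G M e"
  shows "G \<turnstile> unique_elim_structure i M e \<Colon> U (Suc i)"
  unfolding unique_elim_alt
  using family_ctx(4-)[OF assms]
  by (intro Pi_family_form[OF assms] U_cumul is_equiv_form modal_sections_form modal_family_form
    restriction_typing)

lemma higher_data_unique_elim:
  assumes h: "higher_data i G M e ind cmp mid"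
  shows "\<exists>t. G \<turnstile> t \<Colon> unique_elim_structure i M e"
proof -
  have d: "modal_data i G M e"
    using h by (simp add: higher_data_def)
  note ctx = family_ctx[OF d]
  have "higher_data i ((ren Suc M \<cdot> Var 0 \<rightharpoondown> U i) # U i # G)
      (shift 2 M) (shift 2 e) (shift 2 ind) (shift 2 cmp) (shift 2 mid)"
    using weaken_higher[OF weaken_higher[OF h ctx(2)] ctx(3)] by (simp add: calc)
  from restriction_is_equiv[OF this ctx(5,6)]
  show ?thesis
    unfolding unique_elim_alt shift_def[of 1] by (auto intro: Pi_intro)
qed

lemma times_fst:
  assumes "G \<turnstile> A \<Colon> U i" "G \<turnstile> B \<Colon> U i" "G \<turnstile> p \<Colon> A \<otimes> B"
  shows "\<exists>a. G \<turnstile> a \<Colon> A"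
  using Sig_fst[OF assms(1) weaken_U[OF assms(2) ctx_ext[OF assms(1)]]] assms(3)
  unfolding times_def shift_def by auto

lemma times_snd:
  assumes "G \<turnstile> A \<Colon> U i" "G \<turnstile> B \<Colon> U i" "G \<turnstile> p \<Colon> A \<otimes> B"
  shows "\<exists>b. G \<turnstile> b \<Colon> B"
proof -
  note B1 = weaken_U[OF assms(2) ctx_ext[OF assms(1)]]
  have "ren Suc B # A # G \<turnstile> Var 0 \<Colon> ren (\<lambda>n. Suc (Suc n)) B"
    using Var0[OF ctx_ext[OF B1]] by (simp add: calc)
  from Sig_rec[OF assms(1) B1 assms(2) this] assms(3) show ?thesis
    unfolding times_def shift_def by auto
qed

text \<open>
  The induction principle and its computation rule form a dependent pair, so they are eliminated
  together, into a type that does not mention them.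
\<close>
lemma higher_structure_unique_elim:
  assumes d: "modal_data i G M e" and s: "G \<turnstile> s \<Colon> higher_modality_structure i M e"
  shows "\<exists>t. G \<turnstile> t \<Colon> unique_elim_structure i M e"
proof -
  let ?I = "ind_type i M e" and ?C = "comp_type i (shift 1 M) (shift 1 e) (Var 0)"
  note parts = ind_comp_parts[OF d]
  note s' = s[unfolded higher_modality_structure_def]
  obtain mid where mid: "G \<turnstile> mid \<Colon> modal_id_type i M e"
    using times_snd[OF parts(2) modal_id_form[OF d] s'] by blast
  obtain p where p: "G \<turnstile> p \<Colon> Sig ?I ?C"
    using times_fst[OF parts(2) modal_id_form[OF d] s'] by blast
  note wf1 = ctx_ext[OF ind_form[OF d]] and wf2 = ctx_ext[OF parts(1)]
  have "higher_data i (?C # ?I # G) (ren (\<lambda>n. Suc (Suc n)) M) (ren (\<lambda>n. Suc (Suc n)) e)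
      (Var 1) (Var 0) (ren (\<lambda>n. Suc (Suc n)) mid)"
    using weaken_data[OF weaken_data[OF d wf1] wf2] weaken[OF wf2 weaken[OF wf1 mid]]
      Var0[OF wf2] VarS[OF wf2 Var0[OF wf1]]
    by (simp add: higher_data_def modal_calc)
  from higher_data_unique_elim[OF this]
  obtain t where "?C # ?I # G \<turnstile> t \<Colon> ren (\<lambda>n. Suc (Suc n)) (unique_elim_structure i M e)"
    by (auto simp: modal_ren)
  from Sig_rec[OF ind_form[OF d] parts(1) unique_elim_form[OF d] this p] show ?thesis by blast
qed

section \<open>Congruence of types\<close>

lemma inst_subst_up: "inst 0 e (subst (up (scons M Var)) B) = subst (scons e (scons M Var)) B"
proof -
  have "(\<lambda>n. subst (scons e Var) (up (scons M Var) n)) = scons e (scons M Var)"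
    by (rule ext, rename_tac n, case_tac n) (auto simp: calc)
  then show ?thesis by (simp add: inst_def subst_subst)
qed

text \<open>
  Both sides are \<open>\<beta>\<close>-reducts of applications of \<open>\<lambda>x. B\<close>, and application respects judgemental equality.
\<close>
lemma type_cong:
  assumes B: "A # G \<turnstile> B \<Colon> U j" and a: "G \<turnstile> a \<Colon> A" "G \<turnstile> a' \<Colon> A" and eq: "G \<turnstile> a \<doteq> a' \<Colon> A"
  shows "G \<turnstile> inst 0 a B \<doteq> inst 0 a' B \<Colon> U j"
proof -
  have beta: "G \<turnstile> Lam A B \<cdot> a \<doteq> inst 0 a B \<Colon> U j" if "G \<turnstile> a \<Colon> A" for a
    using Pi_comp[OF B that] by (simp add: calc)
  have "G \<turnstile> Lam A B \<cdot> a \<doteq> Lam A B \<cdot> a' \<Colon> U j"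
    using Pi_elim_eq[OF eq_refl[OF Pi_intro[OF B]] eq] by (simp add: calc)
  then show ?thesis
    by (blast intro: eq_trans eq_sym beta a)
qed

lemma unit_type_cong:
  assumes M: "G \<turnstile> M \<Colon> operator_type i" "G \<turnstile> M' \<Colon> operator_type i" "G \<turnstile> M \<doteq> M' \<Colon> operator_type i"
  shows "G \<turnstile> unit_type i M \<doteq> unit_type i M' \<Colon> U (Suc i)"
proof -
  note wf = ctx_ext[OF operator_form[OF typing_wf[OF M(1)]]]
  have "operator_type i # G \<turnstile> unit_type i (Var 0) \<Colon> U (Suc i)"
    using Var0[OF wf] by (intro unit_form) (simp add: modal_ren)
  from type_cong[OF this M] show ?thesis
    by (simp add: inst_def modal_subst)
qed

text \<open>
  The same for two variables, where the type of the second one changes with the first: abstracting over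
  both turns the change of type into a part of the rule for application.  After the first reduction
  the body is an instance of \<open>B\<close> in one variable, whose well-formedness is supplied by the premise
  \<open>inst\<close>; for the concrete \<open>B\<close> it is the formation rule at \<open>M\<close>.
\<close>
lemma data_type_cong:
  assumes B: "unit_type i (Var 0) # operator_type i # G \<turnstile> B \<Colon> U j"
    and inst: "\<And>M. G \<turnstile> M \<Colon> operator_type i \<Longrightarrow>
      unit_type i M # G \<turnstile> subst (up (scons M Var)) B \<Colon> U j"
    and d: "modal_data i G M e" "modal_data i G M' e'"
    and eq: "G \<turnstile> M \<doteq> M' \<Colon> operator_type i" "G \<turnstile> e \<doteq> e' \<Colon> unit_type i M"
  shows "G \<turnstile> subst (scons e (scons M Var)) B \<doteq> subst (scons e' (scons M' Var)) B \<Colon> U j"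
proof -
  let ?K = "Lam (operator_type i) (Lam (unit_type i (Var 0)) B)"
  note inner = Pi_intro[OF B]
  have "G \<turnstile> ?K \<cdot> M \<doteq> ?K \<cdot> M' \<Colon> Pi (unit_type i M) (U j)"
    using Pi_elim_eq[OF eq_refl[OF Pi_intro[OF inner]] eq(1)] by (simp add: inst_def modal_subst)
  from Pi_elim_eq[OF this eq(2)]
  have mid: "G \<turnstile> ?K \<cdot> M \<cdot> e \<doteq> ?K \<cdot> M' \<cdot> e' \<Colon> U j"
    by (simp add: inst_def)
  have beta: "G \<turnstile> ?K \<cdot> M \<cdot> e \<doteq> subst (scons e (scons M Var)) B \<Colon> U j" if d: "modal_data i G M e" for M e
  proof -
    note M = data_operator[OF d] and e = data_unit[OF d]
    have "G \<turnstile> ?K \<cdot> M \<doteq> Lam (unit_type i M) (subst (up (scons M Var)) B) \<Colon> Pi (unit_type i M) (U j)"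
      using Pi_comp[OF inner M] by (simp add: inst_def modal_subst)
    from Pi_elim_eq[OF this eq_refl[OF e]]
    have "G \<turnstile> ?K \<cdot> M \<cdot> e \<doteq> Lam (unit_type i M) (subst (up (scons M Var)) B) \<cdot> e \<Colon> U j"
      by (simp add: inst_def)
    moreover have "G \<turnstile> Lam (unit_type i M) (subst (up (scons M Var)) B) \<cdot> e
        \<doteq> subst (scons e (scons M Var)) B \<Colon> U j"
      using Pi_comp[OF inst[OF M] e] unfolding inst_subst_up by (simp add: inst_def)
    ultimately show ?thesis by (rule eq_trans)
  qed
  show ?thesis
    by (rule eq_trans[OF eq_sym[OF beta[OF d(1)]] eq_trans[OF mid beta[OF d(2)]]])
qed

lemma unit_ctx:
  assumes "G \<turnstile> M \<Colon> operator_type i"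
  shows "wf_ctx (unit_type i M # G)" "modal_data i (unit_type i M # G) (ren Suc M) (Var 0)"
proof -
  show wf: "wf_ctx (unit_type i M # G)"
    by (rule ctx_ext[OF unit_form[OF assms]])
  show "modal_data i (unit_type i M # G) (ren Suc M) (Var 0)"
    using weaken_operator[OF assms wf] Var0[OF wf] by (simp add: modal_data_def modal_ren)
qed

lemma operator_ctx:
  assumes "wf_ctx G"
  shows "wf_ctx (operator_type i # G)" "operator_type i # G \<turnstile> Var 0 \<Colon> operator_type i"
proof -
  show wf: "wf_ctx (operator_type i # G)"
    by (rule ctx_ext[OF operator_form[OF assms]])
  show "operator_type i # G \<turnstile> Var 0 \<Colon> operator_type i"
    using Var0[OF wf] by (simp add: modal_ren)
qed

lemma is_modal_cong:
  assumes d: "modal_data i G M e" "modal_data i G M' e'"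
    and eq: "G \<turnstile> M \<doteq> M' \<Colon> operator_type i" "G \<turnstile> e \<doteq> e' \<Colon> unit_type i M"
    and X: "G \<turnstile> X \<Colon> U i"
  shows "G \<turnstile> is_modal M e X \<doteq> is_modal M' e' X \<Colon> U i"
proof -
  note op = operator_ctx[OF typing_wf[OF X], of i]
  let ?B = "is_modal (Var 1) (Var 0) (ren (\<lambda>n. Suc (Suc n)) X)"
  have B: "unit_type i (Var 0) # operator_type i # G \<turnstile> ?B \<Colon> U i"
    using is_modal_form[OF unit_ctx(2)[OF op(2)] weaken_U[OF weaken_U[OF X op(1)] unit_ctx(1)[OF op(2)]]]
    by (simp add: calc)
  have inst: "unit_type i M # G \<turnstile> subst (up (scons M Var)) ?B \<Colon> U i"
    if "G \<turnstile> M \<Colon> operator_type i" for M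
    using is_modal_form[OF unit_ctx(2)[OF that] weaken_U[OF X unit_ctx(1)[OF that]]]
    by (simp add: modal_calc)
  from data_type_cong[OF B inst d eq] show ?thesis
    by (simp add: modal_calc)
qed

section \<open>Operator, unit and structure as iterated pairs\<close>

text \<open>
  Higher and uniquely eliminating modalities differ only in the third component \<open>S M e\<close>, and the
  projections \<open>operator_of\<close> and \<open>unit_of\<close> do not see it.  Their theory is developed for any \<open>S\<close> that is
  a type for all operators and units and commutes with substitution.
\<close>
locale modality_notion =
  fixes i :: nat and S :: "tm \<Rightarrow> tm \<Rightarrow> tm"
  assumes S_form: "modal_data i G M e \<Longrightarrow> G \<turnstile> S M e \<Colon> U (Suc i)"
    and S_subst: "subst s (S M e) = S (subst s M) (subst s e)"
begin

lemma S_ren: "ren r (S M e) = S (ren r M) (ren r e)"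
  by (simp add: ren_as_subst S_subst)

definition fiber :: "tm \<Rightarrow> tm" where
  "fiber M = Sig (unit_type i M) (S (ren Suc M) (Var 0))"

definition total :: tm where
  "total = Sig (operator_type i) (fiber (Var 0))"

lemma fiber_ren: "ren r (fiber M) = fiber (ren r M)"
  and fiber_subst: "subst s (fiber M) = fiber (subst s M)"
  and total_ren: "ren r total = total"
  and total_subst: "subst s total = total"
  by (simp_all add: fiber_def total_def S_ren S_subst modal_calc)

lemma operator_of_ren: "ren r (operator_of i m) = operator_of i (ren r m)"
  and operator_of_subst: "subst s (operator_of i m) = operator_of i (subst s m)"
  and unit_of_ren: "ren r (unit_of i m) = unit_of i (ren r m)"
  and unit_of_subst: "subst s (unit_of i m) = unit_of i (subst s m)"
  by (simp_all add: operator_of_def unit_of_def modal_calc)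

lemmas record_calc = fiber_ren fiber_subst total_ren total_subst operator_of_ren operator_of_subst
  unit_of_ren unit_of_subst S_ren S_subst modal_calc

lemma S_cong:
  assumes d: "modal_data i G M e" "modal_data i G M' e'"
    and eq: "G \<turnstile> M \<doteq> M' \<Colon> operator_type i" "G \<turnstile> e \<doteq> e' \<Colon> unit_type i M"
  shows "G \<turnstile> S M e \<doteq> S M' e' \<Colon> U (Suc i)"
proof -
  have B: "unit_type i (Var 0) # operator_type i # G \<turnstile> S (Var 1) (Var 0) \<Colon> U (Suc i)"
    using S_form[OF unit_ctx(2)[OF operator_ctx(2)[OF data_wf[OF d(1)]]]] by simp
  have inst: "unit_type i M # G \<turnstile> subst (up (scons M Var)) (S (Var 1) (Var 0)) \<Colon> U (Suc i)"
    if "G \<turnstile> M \<Colon> operator_type i" for M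
    using S_form[OF unit_ctx(2)[OF that]] by (simp add: record_calc)
  from data_type_cong[OF B inst d eq] show ?thesis
    by (simp add: record_calc)
qed

lemma S_body_form: "G \<turnstile> M \<Colon> operator_type i \<Longrightarrow> unit_type i M # G \<turnstile> S (ren Suc M) (Var 0) \<Colon> U (Suc i)"
  by (rule S_form[OF unit_ctx(2)])

lemma fiber_form: "G \<turnstile> M \<Colon> operator_type i \<Longrightarrow> G \<turnstile> fiber M \<Colon> U (Suc i)"
  unfolding fiber_def by (intro Sig_form unit_form S_body_form)

lemma fiber_body_form: "wf_ctx G \<Longrightarrow> operator_type i # G \<turnstile> fiber (Var 0) \<Colon> U (Suc i)"
  by (rule fiber_form[OF operator_ctx(2)])

lemma total_form: "wf_ctx G \<Longrightarrow> G \<turnstile> total \<Colon> U (Suc i)"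
  unfolding total_def by (intro Sig_form operator_form fiber_body_form)

lemma fiber_pair:
  assumes d: "modal_data i G M e" and s: "G \<turnstile> s \<Colon> S M e"
  shows "G \<turnstile> Pair e s \<Colon> fiber M"
  unfolding fiber_def
  using s by (intro Sig_intro[OF S_body_form] data_operator[OF d] data_unit[OF d])
    (simp add: record_calc)

lemma total_pair:
  assumes M: "G \<turnstile> M \<Colon> operator_type i" and q: "G \<turnstile> q \<Colon> fiber M"
  shows "G \<turnstile> Pair M q \<Colon> total"
  unfolding total_def
  using q by (intro Sig_intro[OF fiber_body_form] M typing_wf[OF M]) (simp add: record_calc)

lemma fiber_ctx:
  assumes "wf_ctx G"
  defines "D \<equiv> fiber (Var 0) # operator_type i # G"
  shows "wf_ctx D" "D \<turnstile> Var 1 \<Colon> operator_type i" "D \<turnstile> Var 0 \<Colon> fiber (Var 1)"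
  using ctx_ext[OF fiber_body_form[OF assms(1)]] VarS[OF ctx_ext[OF fiber_body_form[OF assms(1)]] operator_ctx(2)[OF assms(1)]]
    Var0[OF ctx_ext[OF fiber_body_form[OF assms(1)]]]
  by (simp_all add: D_def record_calc)

lemma operator_of_motive: "wf_ctx G \<Longrightarrow> total # G \<turnstile> operator_type i \<Colon> U (Suc i)"
  by (intro operator_form ctx_ext[OF total_form])

lemma operator_of_typing: "G \<turnstile> m \<Colon> total \<Longrightarrow> G \<turnstile> operator_of i m \<Colon> operator_type i"
  using Sig_elim[OF operator_of_motive[unfolded total_def], of G "Var 1" m] typing_wf[of G m total]
    fiber_ctx(2)[of G]
  by (simp add: operator_of_def total_def record_calc)

lemma operator_of_cong: "G \<turnstile> m \<doteq> m' \<Colon> total \<Longrightarrow> G \<turnstile> operator_of i m \<doteq> operator_of i m' \<Colon> operator_type i"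
  using Sig_elim_eq[OF eq_refl[OF operator_of_motive[unfolded total_def]] eq_refl, of G "Var 1" m m']
    judg_eq_wf[of G m m' total] fiber_ctx(2)[of G]
  by (simp add: operator_of_def total_def record_calc)

lemma operator_of_pair:
  assumes M: "G \<turnstile> M \<Colon> operator_type i" and q: "G \<turnstile> q \<Colon> fiber M"
  shows "G \<turnstile> operator_of i (Pair M q) \<doteq> M \<Colon> operator_type i"
  using Sig_comp[OF operator_of_motive[unfolded total_def], of G "Var 1" M q] typing_wf[OF M] M q
    fiber_ctx(2)[of G]
  by (simp add: operator_of_def total_def record_calc)

text \<open>
  The motive of \<open>unit_of\<close> at a pair mentions the operator of that pair; its computation rule therefore
  has to be converted along this equality.
\<close>
lemma unit_type_operator_of_pair:
  assumes M: "G \<turnstile> M \<Colon> operator_type i" and q: "G \<turnstile> q \<Colon> fiber M"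
  shows "G \<turnstile> unit_type i (operator_of i (Pair M q)) \<doteq> unit_type i M \<Colon> U (Suc i)"
  by (rule unit_type_cong[OF operator_of_typing[OF total_pair[OF M q]] M operator_of_pair[OF M q]])

lemma fiber_fst:
  assumes M: "G \<turnstile> M \<Colon> operator_type i" and q: "G \<turnstile> q \<Colon> fiber M"
  shows "G \<turnstile> IndSig (unit_type i (ren Suc M)) (Var 1) q \<Colon> unit_type i M"
  using Sig_fst[OF unit_form[OF M] S_body_form[OF M] q[unfolded fiber_def]] by (simp add: modal_ren)

lemma total_ctx:
  assumes "wf_ctx G"
  shows "wf_ctx (total # G)" "total # G \<turnstile> Var 0 \<Colon> total"
  using ctx_ext[OF total_form[OF assms]] Var0[OF ctx_ext[OF total_form[OF assms]]]
  by (simp_all add: total_ren)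

lemma unit_of_motive: "wf_ctx G \<Longrightarrow> total # G \<turnstile> unit_type i (operator_of i (Var 0)) \<Colon> U (Suc i)"
  by (intro unit_form operator_of_typing total_ctx)

lemma unit_of_branch:
  assumes "wf_ctx G"
  shows "fiber (Var 0) # operator_type i # G \<turnstile> IndSig (unit_type i (Var 2)) (Var 1) (Var 0)
    \<Colon> inst 2 (Pair (Var 1) (Var 0)) (unit_type i (operator_of i (Var 0)))"
  using conv[OF fiber_fst[OF fiber_ctx(2,3)[OF assms]]
      eq_sym[OF unit_type_operator_of_pair[OF fiber_ctx(2,3)[OF assms]]]]
  by (simp add: record_calc)

lemma unit_of_typing: "G \<turnstile> m \<Colon> total \<Longrightarrow> G \<turnstile> unit_of i m \<Colon> unit_type i (operator_of i m)"
  using Sig_elim[OF unit_of_motive[unfolded total_def] unit_of_branch, of G m] typing_wf[of G m total]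
  by (simp add: unit_of_def total_def record_calc)

lemma data_of: "G \<turnstile> m \<Colon> total \<Longrightarrow> modal_data i G (operator_of i m) (unit_of i m)"
  by (simp add: modal_data_def operator_of_typing unit_of_typing)

lemma unit_of_cong:
  "G \<turnstile> m \<doteq> m' \<Colon> total \<Longrightarrow> G \<turnstile> unit_of i m \<doteq> unit_of i m' \<Colon> unit_type i (operator_of i m)"
  using Sig_elim_eq[OF eq_refl[OF unit_of_motive[unfolded total_def]] eq_refl[OF unit_of_branch], of G m m']
    judg_eq_wf[of G m m' total]
  by (simp add: unit_of_def total_def record_calc)

lemma unit_of_pair_typing:
  assumes M: "G \<turnstile> M \<Colon> operator_type i" and q: "G \<turnstile> q \<Colon> fiber M"
  shows "G \<turnstile> unit_of i (Pair M q) \<Colon> unit_type i M"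
  by (rule conv[OF unit_of_typing[OF total_pair[OF M q]] unit_type_operator_of_pair[OF M q]])

text \<open>
  Two reductions, of the outer pair to the elimination of the inner pair, and of the latter to \<open>e\<close>.
\<close>
lemma unit_of_pair:
  assumes d: "modal_data i G M e" and s: "G \<turnstile> s \<Colon> S M e"
  shows "G \<turnstile> unit_of i (Pair M (Pair e s)) \<doteq> e \<Colon> unit_type i M"
proof -
  note M = data_operator[OF d] and e = data_unit[OF d] and wf = data_wf[OF d]
  note q = fiber_pair[OF d s]
  have "G \<turnstile> Pair e s \<Colon> inst 0 M (fiber (Var 0))"
    using q by (simp add: record_calc)
  from Sig_comp[OF unit_of_motive[OF wf, unfolded total_def] unit_of_branch[OF wf] M this]
  have "G \<turnstile> unit_of i (Pair M (Pair e s)) \<doteq> IndSig (unit_type i (ren Suc M)) (Var 1) (Pair e s)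
      \<Colon> unit_type i (operator_of i (Pair M (Pair e s)))"
    by (simp add: unit_of_def record_calc)
  then have "G \<turnstile> unit_of i (Pair M (Pair e s)) \<doteq> IndSig (unit_type i (ren Suc M)) (Var 1) (Pair e s)
      \<Colon> unit_type i M"
    by (rule eq_conv[OF _ unit_type_operator_of_pair[OF M q]])
  moreover have "G \<turnstile> IndSig (unit_type i (ren Suc M)) (Var 1) (Pair e s) \<doteq> e \<Colon> unit_type i M"
  proof -
    have "Sig (unit_type i M) (S (ren Suc M) (Var 0)) # G \<turnstile> unit_type i (ren Suc M) \<Colon> U (Suc i)"
      by (intro unit_form weaken_operator M ctx_ext[OF fiber_form[OF M, unfolded fiber_def]])
    moreover have "S (ren Suc M) (Var 0) # unit_type i M # G \<turnstile> Var 1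
        \<Colon> inst 2 (Pair (Var 1) (Var 0)) (unit_type i (ren Suc M))"
      using VarS[OF ctx_ext[OF S_body_form[OF M]] Var0[OF unit_ctx(1)[OF M]]] by (simp add: record_calc)
    moreover have "G \<turnstile> s \<Colon> inst 0 e (S (ren Suc M) (Var 0))"
      using s by (simp add: record_calc)
    ultimately show ?thesis
      using Sig_comp[OF _ _ e] by (fastforce simp: record_calc)
  qed
  ultimately show ?thesis by (rule eq_trans)
qed

text \<open>
  Elimination of the inner pair with the operator held fixed.  The goal is stated with the unit of the
  whole pair, because \<open>S\<close> has to depend on the variable that is eliminated.
\<close>
lemma fiber_structure:
  assumes M: "G \<turnstile> M \<Colon> operator_type i" and q: "G \<turnstile> q \<Colon> fiber M"
  shows "\<exists>t. G \<turnstile> t \<Colon> S M (unit_of i (Pair M q))"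
proof -
  let ?C = "S (ren Suc M) (unit_of i (Pair (ren Suc M) (Var 0)))"
  have C: "fiber M # G \<turnstile> ?C \<Colon> U (Suc i)"
  proof -
    note wf = ctx_ext[OF fiber_form[OF M]]
    have "fiber M # G \<turnstile> Var 0 \<Colon> fiber (ren Suc M)"
      using Var0[OF wf] by (simp add: record_calc)
    with weaken_operator[OF M wf] show ?thesis
      by (intro S_form) (simp add: modal_data_def unit_of_pair_typing)
  qed
  let ?D = "S (ren Suc M) (Var 0) # unit_type i M # G" and ?M = "ren (\<lambda>n. Suc (Suc n)) M"
  note wf = ctx_ext[OF S_body_form[OF M]]
  have d: "modal_data i ?D ?M (Var 1)"
    using weaken_data[OF unit_ctx(2)[OF M] wf] by (simp add: calc)
  have s: "?D \<turnstile> Var 0 \<Colon> S ?M (Var 1)"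
    using Var0[OF wf] by (simp add: record_calc)
  note q2 = fiber_pair[OF d s]
  have "modal_data i ?D ?M (unit_of i (Pair ?M (Pair (Var 1) (Var 0))))"
    using d q2 by (simp add: modal_data_def unit_of_pair_typing)
  from S_cong[OF d this eq_refl[OF data_operator[OF d]] eq_sym[OF unit_of_pair[OF d s]]]
  have "?D \<turnstile> Var 0 \<Colon> S ?M (unit_of i (Pair ?M (Pair (Var 1) (Var 0))))"
    by (rule conv[OF s])
  then have "?D \<turnstile> Var 0 \<Colon> inst 2 (Pair (Var 1) (Var 0)) ?C"
    by (simp add: record_calc)
  from Sig_elim[OF C[unfolded fiber_def] this q[unfolded fiber_def]] show ?thesis
    by (auto simp: record_calc)
qed

text \<open>
  The third projection, of which only the type matters: the map in the main theorem uses it as a source of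
  proofs, and equality is claimed for the first two projections alone.
\<close>
lemma structure_of:
  assumes m: "G \<turnstile> m \<Colon> total"
  shows "\<exists>t. G \<turnstile> t \<Colon> S (operator_of i m) (unit_of i m)"
proof -
  note wf = typing_wf[OF m]
  note ctx = fiber_ctx(2,3)[OF wf]
  let ?D = "fiber (Var 0) # operator_type i # G" and ?p = "Pair (Var 1) (Var 0)"
  have p: "?D \<turnstile> ?p \<Colon> total"
    by (rule total_pair[OF ctx])
  have "modal_data i ?D (Var 1) (unit_of i ?p)"
    using ctx(1) unit_of_pair_typing[OF ctx] by (simp add: modal_data_def)
  from S_cong[OF data_of[OF p] this operator_of_pair[OF ctx] eq_refl[OF unit_of_typing[OF p]]]
  obtain t where "?D \<turnstile> t \<Colon> S (operator_of i ?p) (unit_of i ?p)"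
    using fiber_structure[OF ctx] by (blast intro: conv eq_sym)
  then have t: "?D \<turnstile> t \<Colon> inst 2 ?p (S (operator_of i (Var 0)) (unit_of i (Var 0)))"
    by (simp add: record_calc)
  have C: "total # G \<turnstile> S (operator_of i (Var 0)) (unit_of i (Var 0)) \<Colon> U (Suc i)"
    by (rule S_form[OF data_of[OF total_ctx(2)[OF wf]]])
  from Sig_elim[OF C[unfolded total_def] t m[unfolded total_def]] show ?thesis
    by (auto simp: record_calc)
qed

end

interpretation higher: modality_notion i "higher_modality_structure i" for i
  by standard (simp_all add: higher_structure_form modal_subst)

interpretation unique: modality_notion i "unique_elim_structure i" for i
  by standard (simp_all add: unique_elim_form modal_subst)

lemma higher_total: "higher.total i = Higher_Modality i"
  and unique_total: "unique.total i = Uniquely_Eliminating_Modality i"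
  by (simp_all add: higher.total_def unique.total_def higher.fiber_def unique.fiber_def
    Higher_Modality_def Uniquely_Eliminating_Modality_def)

section \<open>Higher modalities are uniquely eliminating\<close>

theorem mainTheorem9:
  fixes i :: nat
  shows "\<exists>t. [] \<turnstile> t \<Colon> Higher_Modality i \<rightharpoondown> Uniquely_Eliminating_Modality i \<and>
    (\<forall>G m. G \<turnstile> m \<Colon> Higher_Modality i \<longrightarrow>
      G \<turnstile> t \<cdot> m \<Colon> Uniquely_Eliminating_Modality i \<and>
      G \<turnstile> operator_of i (t \<cdot> m) \<doteq> operator_of i m \<Colon> operator_type i \<and>
      G \<turnstile> unit_of i (t \<cdot> m) \<doteq> unit_of i m \<Colon> unit_type i (operator_of i m) \<and>
      (\<forall>X. G \<turnstile> X \<Colon> U i \<longrightarrow>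
        G \<turnstile> is_modal (operator_of i (t \<cdot> m)) (unit_of i (t \<cdot> m)) X
          \<doteq> is_modal (operator_of i m) (unit_of i m) X \<Colon> U i))"
proof -
  let ?H = "Higher_Modality i" and ?E = "Uniquely_Eliminating_Modality i"
  let ?S = "\<lambda>m. unique_elim_structure i (operator_of i m) (unit_of i m)"
  note H_data = higher.data_of[of _ _ i, unfolded higher_total]
  note H_ctx = higher.total_ctx[of _ i, unfolded higher_total]
  obtain w where "[?H] \<turnstile> w \<Colon> ?S (Var 0)"
    using higher_structure_unique_elim[OF H_data higher.structure_of[of _ _ i, unfolded higher_total, THEN someI_ex]]
      H_ctx(2)[OF ctx_emp] by blast
  \<comment> \<open>Closed, hence available in every context and invariant under substitution.\<close>
  from Pi_intro[OF this]
  obtain w where w: "[] \<turnstile> w \<Colon> Pi ?H (?S (Var 0))"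
    by blast
  define body where "body m = Pair (operator_of i m) (Pair (unit_of i m) (w \<cdot> m))" for m
  have S: "G \<turnstile> w \<cdot> m \<Colon> ?S m" if m: "G \<turnstile> m \<Colon> ?H" for G m
  proof -
    have "ren r (Pi ?H (?S (Var 0))) = Pi ?H (?S (Var 0))" for r
      using higher.total_ren[of r i] by (simp add: higher_total unique.record_calc)
    then have "G \<turnstile> w \<Colon> Pi ?H (?S (Var 0))"
      using weaken_closed[OF w typing_wf[OF m]] by metis
    from Pi_elim[OF this m] show ?thesis
      by (simp add: unique.record_calc)
  qed
  have fib: "G \<turnstile> Pair (unit_of i m) (w \<cdot> m) \<Colon> unique.fiber i (operator_of i m)" if m: "G \<turnstile> m \<Colon> ?H" for G m
    by (rule unique.fiber_pair[OF H_data[OF m] S[OF m]])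
  have body: "G \<turnstile> body m \<Colon> ?E" if m: "G \<turnstile> m \<Colon> ?H" for G m
    unfolding body_def unique_total[symmetric]
    by (rule unique.total_pair[OF data_operator[OF H_data[OF m]] fib[OF m]])
  define t where "t = Lam ?H (body (Var 0))"
  have E_ren: "ren r ?E = ?E" for r
    using unique.total_ren[of r i] by (simp add: unique_total)
  have t: "G \<turnstile> t \<Colon> ?H \<rightharpoondown> ?E" if "wf_ctx G" for G
    unfolding t_def by (rule arr_intro) (simp add: E_ren body H_ctx(2) that)
  have beta: "G \<turnstile> t \<cdot> m \<doteq> body m \<Colon> ?E" if m: "G \<turnstile> m \<Colon> ?H" for G m
  proof -
    have "?H # G \<turnstile> body (Var 0) \<Colon> ?E"
      by (rule body[OF H_ctx(2)[OF typing_wf[OF m]]])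
    moreover have "inst 0 m (body (Var 0)) = body m"
      by (simp add: body_def unique.record_calc closed_subst[OF w])
    moreover have "inst 0 m ?E = ?E"
      using unique.total_subst[of _ i] by (simp add: unique_total inst_def)
    ultimately show ?thesis
      using Pi_comp[of ?H G "body (Var 0)" ?E m] m by (simp add: t_def)
  qed
  have main: "G \<turnstile> t \<cdot> m \<Colon> ?E"
      "G \<turnstile> operator_of i (t \<cdot> m) \<doteq> operator_of i m \<Colon> operator_type i"
      "G \<turnstile> unit_of i (t \<cdot> m) \<doteq> unit_of i m \<Colon> unit_type i (operator_of i m)"
    if m: "G \<turnstile> m \<Colon> ?H" for G m
  proof -
    note d = H_data[OF m]
    show tm: "G \<turnstile> t \<cdot> m \<Colon> ?E"
      by (rule arr_elim[OF t[OF typing_wf[OF m]] m])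
    note beta' = beta[OF m, folded unique_total] and tm' = tm[folded unique_total]
    show op: "G \<turnstile> operator_of i (t \<cdot> m) \<doteq> operator_of i m \<Colon> operator_type i"
      by (rule eq_trans[OF unique.operator_of_cong[OF beta']])
        (unfold body_def, rule unique.operator_of_pair[OF data_operator[OF d] fib[OF m]])
    have "G \<turnstile> unit_type i (operator_of i (t \<cdot> m)) \<doteq> unit_type i (operator_of i m) \<Colon> U (Suc i)"
      by (rule unit_type_cong[OF unique.operator_of_typing[OF tm'] data_operator[OF d] op])
    from eq_conv[OF unique.unit_of_cong[OF beta'] this]
    show "G \<turnstile> unit_of i (t \<cdot> m) \<doteq> unit_of i m \<Colon> unit_type i (operator_of i m)"
      by (rule eq_trans) (unfold body_def, rule unique.unit_of_pair[OF d S[OF m]])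
  qed
  have modal: "G \<turnstile> is_modal (operator_of i (t \<cdot> m)) (unit_of i (t \<cdot> m)) X
      \<doteq> is_modal (operator_of i m) (unit_of i m) X \<Colon> U i"
    if m: "G \<turnstile> m \<Colon> ?H" and X: "G \<turnstile> X \<Colon> U i" for G m X
  proof -
    have d: "modal_data i G (operator_of i (t \<cdot> m)) (unit_of i (t \<cdot> m))"
      by (rule unique.data_of[OF main(1)[OF m, folded unique_total]])
    have "G \<turnstile> unit_type i (operator_of i m) \<doteq> unit_type i (operator_of i (t \<cdot> m)) \<Colon> U (Suc i)"
      by (rule eq_sym[OF unit_type_cong[OF data_operator[OF d] data_operator[OF H_data[OF m]] main(2)[OF m]]])
    from is_modal_cong[OF d H_data[OF m] main(2)[OF m] eq_conv[OF main(3)[OF m] this] X]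
    show ?thesis .
  qed
  show ?thesis
    using t[OF ctx_emp] main modal by blast
qed

end
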